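(* Let $\Phi$ be a stable, tempered, central pair potential with stability constant $B\ge 0$, let $\beta>0$, and put $u:=e^{2\beta B}$. Let $c(u)$ be the smallest positive solution $c$, with $0<uc<1/e$, of $$u c\, T_{1}'(uc)-T_{1}(uc)=u .$$ Then for every $n\ge 1$ the virial coefficients satisfy $$\frac{|\beta_{n+1}|}{(n+1)!}\;\le\;\frac{C(\beta)^n}{n+1}\left(\frac{1+\frac{1}{u}T_{1}(uc(u))}{c(u)}\right)^n ,$$ and consequently the radius of convergence $\mathcal R_{\mathrm{Vir}}$ of the series $\sum_{n\ge1}\frac{\beta_n}{n!}\rho^n$ satisfies $$\mathcal{R}_{\mathrm{Vir}}\;\ge\;\frac{c(u)}{1+\frac{1}{u}T_{1}(uc(u))}\,C(\beta)^{-1}.$$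
   Context: Setting: classical gas in $\mathbb R^d$ with pair potential $\Phi(x_i,x_j)=\phi(x_i-x_j)$ depending only on $|x_i-x_j|$. Stability with constant $B$: for all $N$ and all $x_1,\dots,x_N\in\mathbb R^d$, $\sum_{1\le i<j\le N}\Phi(x_i,x_j)\ge -BN$. Mayer function $f(x):=e^{-\beta\phi(x)}-1$, $f_{i,j}:=f(x_i-x_j)$. Temperedness: $C(\beta):=\int_{\mathbb R^d}|e^{-\beta\phi(x)}-1|\,dx<\infty$. Cluster coefficients: $b_n:=\sum_{g\in\mathcal C[n]}\int_{(\mathbb R^d)^{n-1}}\prod_{\{i,j\}\in E(g)}f_{i,j}\,dx_2\cdots dx_n$ with $x_1=0$, where $\mathcal C[n]$ is the set of connected graphs on vertex set $\{1,\dots,n\}$ (so $b_1=1$). Let $P(z)=\sum_{n\ge1}b_n z^n/n!$ and $\rho(z)=zP'(z)=\sum_{n\ge1}b_n z^n/(n-1)!$ as formal power series. The virial coefficients $\beta_n$ are defined by $P(z(\rho))=\sum_{n\ge1}\beta_n\rho^n/n!$, where $z(\rho)$ is the compositional inverse of $\rho(z)$; equivalently $\beta_{n+1}=n!\,[z^n]\big(\rho(z)/z\big)^{-n}$. $T_1$ is the power series $T_1(z):=z+\sum_{n\ge1}n^n\frac{z^{n+1}}{(n+1)!}$ (radius of convergence $1/e$), and $T_1'$ its derivative. *)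

theory Defs
  imports "HOL-Analysis.Analysis" "HOL-Computational_Algebra.Formal_Power_Series"
begin

text \<open>Pair potential phi on a Euclidean space 'a (dimension d = DIM('a)), with values in
  ereal (value +infinity allowed for hard cores).\<close>

definition central :: "('a::euclidean_space \<Rightarrow> ereal) \<Rightarrow> bool" where
  "central \<phi> \<longleftrightarrow> (\<forall>x y. norm x = norm y \<longrightarrow> \<phi> x = \<phi> y)"

definition stable_with :: "('a::euclidean_space \<Rightarrow> ereal) \<Rightarrow> real \<Rightarrow> bool" where
  "stable_with \<phi> B \<longleftrightarrow>
     (\<forall>(N::nat) (x::nat \<Rightarrow> 'a).
        (\<Sum>i<N. \<Sum>j\<in>{i<..<N}. \<phi> (x i - x j)) \<ge> ereal (- B * real N))"

text \<open>Mayer function f(x) = exp(-beta phi(x)) - 1, with exp(-infinity) = 0.\<close>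
definition mayer :: "real \<Rightarrow> ('a::euclidean_space \<Rightarrow> ereal) \<Rightarrow> 'a \<Rightarrow> real" where
  "mayer \<beta> \<phi> x = (if \<phi> x = \<infinity> then -1 else exp (- \<beta> * real_of_ereal (\<phi> x)) - 1)"

text \<open>C(beta) = integral of |f| over R^d.\<close>
definition Cbeta :: "real \<Rightarrow> ('a::euclidean_space \<Rightarrow> ereal) \<Rightarrow> real" where
  "Cbeta \<beta> \<phi> = (\<integral>x. \<bar>mayer \<beta> \<phi> x\<bar> \<partial>(lborel :: 'a measure))"

text \<open>Connected simple graphs on vertex set {0..<n} (vertices shifted by one w.r.t. the
  paper's {1..n}); edges are stored as pairs (i,j) with i < j.\<close>
definition conn_graphs :: "nat \<Rightarrow> (nat \<times> nat) set set" where
  "conn_graphs n = {E. E \<subseteq> {(i,j). i < j \<and> j < n} \<and>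
                        (\<forall>k<n. (0, k) \<in> (E \<union> E\<inverse>)\<^sup>*)}"

text \<open>Cluster coefficients: vertex 0 pinned at the origin, integrate x_1..x_{n-1}.\<close>
definition cluster_coeff :: "real \<Rightarrow> ('a::euclidean_space \<Rightarrow> ereal) \<Rightarrow> nat \<Rightarrow> real" where
  "cluster_coeff \<beta> \<phi> n =
     (\<Sum>E\<in>conn_graphs n.
        \<integral>x. (\<Prod>(i,j)\<in>E. mayer \<beta> \<phi> ((if i = 0 then 0 else x i) - (if j = 0 then 0 else x j)))
        \<partial>(PiM {1..<n} (\<lambda>_. (lborel :: 'a measure))))"

text \<open>P(z) = sum_{n>=1} b_n z^n / n!  and  rho(z) = z P'(z) as formal power series.\<close>
definition pressure_fps :: "real \<Rightarrow> ('a::euclidean_space \<Rightarrow> ereal) \<Rightarrow> real fps" where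
  "pressure_fps \<beta> \<phi> = Abs_fps (\<lambda>n. if n = 0 then 0 else cluster_coeff \<beta> \<phi> n / fact n)"

definition density_fps :: "real \<Rightarrow> ('a::euclidean_space \<Rightarrow> ereal) \<Rightarrow> real fps" where
  "density_fps \<beta> \<phi> = Abs_fps (\<lambda>n. if n = 0 then 0 else cluster_coeff \<beta> \<phi> n / fact (n - 1))"

text \<open>Virial coefficients: P(z(rho)) = sum_n beta_n rho^n / n!, z(rho) the compositional
  inverse of rho(z).\<close>
definition virial_coeff :: "real \<Rightarrow> ('a::euclidean_space \<Rightarrow> ereal) \<Rightarrow> nat \<Rightarrow> real" where
  "virial_coeff \<beta> \<phi> n =
     fact n * fps_nth (pressure_fps \<beta> \<phi> oo fps_inv (density_fps \<beta> \<phi>)) n"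

text \<open>T_1(z) = z + sum_{n>=1} n^n z^(n+1)/(n+1)!  (index shifted: n = m+1).\<close>
definition T1 :: "real \<Rightarrow> real" where
  "T1 z = z + (\<Sum>m. real (Suc m) ^ Suc m * z ^ (m + 2) / fact (m + 2))"

text \<open>Positive solutions c, with 0 < uc < 1/e, of  u c T1'(uc) - T1(uc) = u.\<close>
definition c_solutions :: "real \<Rightarrow> real set" where
  "c_solutions u = {c. 0 < c \<and> u * c < exp (-1) \<and>
                       u * c * deriv T1 (u * c) - T1 (u * c) = u}"

end

theory Submission
  imports Defs
begin

text \<open>
  By Lagrange inversion, \<open>\<beta>\<^sub>n\<^sub>+\<^sub>1 / (n+1)! = [z\<^sup>n] F\<^sup>n / (n+1)\<close> with \<open>F = z / \<rho>(z)\<close>, so it suffices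
  to show \<open>|[z\<^sup>m] F| \<le> C\<^sup>m u\<^sup>m\<^sup>-\<^sup>1 (m-1)\<^sup>m\<^sup>-\<^sup>1 / m!\<close>, which says that \<open>F\<close> is majorised by
  \<open>1 + T\<^sub>1(u C z) / u\<close>.  The correlation functions satisfy the Kirkwood--Salsburg equations, which are
  linear, so the correlation functions divided by \<open>\<rho>\<close> satisfy them too.  By translation invariance
  the divided one-point function is the constant 1; hence the recursion never returns to \<open>F\<close>, and
  this is what improves on bounding \<open>\<rho>\<close> first and inverting afterwards.  For at least two
  points, stability provides a point whose interaction with the others is at least \<open>-2B\<close>, so each
  step costs a factor \<open>u\<close>; the resulting numerical recursion is solved by Abel-type numbers.
\<close>

unbundle no vec_syntax
unbundle fps_syntax

section \<open>Lagrange inversion and the majorant\<close>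

text \<open>The equation for \<open>c\<close> is the stationarity condition of
  \<open>(1 + T1 (u * c) / u) / c\<close>. The coefficient of order n of \<open>F ^ n\<close> is
  estimated at radius \<open>c / C\<close>, and c(u) is the choice for which this estimate is best.

  \<open>T1\<close> is 1 - exp(-T). With y = u exp(T(u z)) one has z y = T(u z), hence y = u exp(z
  y). For C = 1 the powers y^(n-1) satisfy with equality the recursion for the bounds at n points,
  and the equation at one point then contributes (exp(z y) - 1) / y = T1(u z) / u.

  Two obstacles shape the proof. Exchanging sums and integrals requires absolute integrability; it
  comes from a crude bound, obtained by the same removal of points applied to |f|. Moreover,
  removing a point turns integrated points into fixed ones, so labels keep changing. The functions
  are therefore indexed by finite sets of labels, and their invariance under relabelling is
  established before any power series is formed.\<close>

lemma fps_compose_mult_nth: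
  fixes R a Z :: "'a::comm_ring_1 fps"
  assumes "fps_nth a 0 = 0"
  shows "((R oo a) * Z) $ n = (\<Sum>k\<le>n. R $ k * (a ^ k * Z) $ n)"
proof -
  have 1: "(R oo a) $ i = (\<Sum>k\<le>n. R $ k * (a ^ k) $ i)" if "i \<le> n" for i
    unfolding fps_compose_nth using that assms
    by (intro sum.mono_neutral_left)
       (auto simp: startsby_zero_power_prefix[OF assms, rule_format])
  have "((R oo a) * Z) $ n = (\<Sum>i\<le>n. (\<Sum>k\<le>n. R $ k * (a ^ k) $ i) * Z $ (n - i))"
    by (auto simp: fps_mult_nth 1 atLeast0AtMost intro!: sum.cong)
  also have "\<dots> = (\<Sum>k\<le>n. \<Sum>i\<le>n. R $ k * (a ^ k) $ i * Z $ (n - i))"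
    by (subst sum.swap) (simp add: sum_distrib_right)
  also have "\<dots> = (\<Sum>k\<le>n. R $ k * (a ^ k * Z) $ n)"
    by (simp add: fps_mult_nth sum_distrib_left atLeast0AtMost mult.assoc)
  finally show ?thesis .
qed

text \<open>The coefficient is the residue of a' / a^(m+1) for a = X G, and that function is the
  derivative of -1 / (m a^m). Multiplying by m avoids Laurent series: the product becomes m F^m - X
  (F^m)', whose coefficient of order m cancels.\<close>

lemma residue_lagrange:
  fixes G F :: "real fps"
  assumes GF: "G * F = 1" and "m > 0"
  shows "(fps_deriv (fps_X * G) * F ^ Suc m) $ m = 0"
proof -
  have dG: "fps_deriv G * F = - (G * fps_deriv F)"
    using arg_cong[OF GF, of fps_deriv] by (simp add: add_eq_0_iff mult.commute)
  have "fps_deriv G * F ^ Suc m = - (fps_deriv F * F ^ (m - 1) * (G * F))"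
  proof -
    have "fps_deriv G * F ^ Suc m = (fps_deriv G * F) * (F ^ (m - 1) * F)"
      using \<open>m > 0\<close> by (cases m) (simp_all add: algebra_simps)
    then show ?thesis unfolding dG by (simp add: algebra_simps)
  qed
  then have "fps_deriv G * F ^ Suc m = - (fps_deriv F * F ^ (m - 1))"
    unfolding GF by simp
  then have 2: "of_nat m * (fps_deriv G * F ^ Suc m) = - fps_deriv (F ^ m)"
    by (simp add: fps_deriv_power fps_of_nat mult_ac del: power_Suc)
  have "of_nat m * (fps_deriv (fps_X * G) * F ^ Suc m)
      = of_nat m * ((G * F) * F ^ m) + fps_X * (of_nat m * (fps_deriv G * F ^ Suc m))"
    by (simp add: algebra_simps)
  also have "\<dots> = of_nat m * F ^ m - fps_X * fps_deriv (F ^ m)"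
    unfolding 2 GF by simp
  finally have "(of_nat m * (fps_deriv (fps_X * G) * F ^ Suc m)) $ m = 0"
    using \<open>m > 0\<close> by (simp add: fps_mult_of_nat_nth)
  then show ?thesis using \<open>m > 0\<close> by (simp add: fps_mult_of_nat_nth)
qed

lemma lagrange_inversion:
  fixes G F P :: "real fps"
  assumes GF: "G * F = 1"
  shows "real (Suc n) * (P oo fps_inv (fps_X * G)) $ Suc n = (fps_deriv P * F ^ Suc n) $ n"
proof -
  define a where "a = fps_X * G"
  have G0: "G $ 0 \<noteq> 0"
    using arg_cong[OF GF, of "\<lambda>f. f $ 0"] by auto
  have a0: "a $ 0 = 0" and a1: "a $ 1 \<noteq> 0"
    using G0 by (simp_all add: a_def)
  define Q where "Q = P oo fps_inv a"
  have "Q oo a = P"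
    unfolding Q_def using a0 a1
    by (subst fps_compose_assoc[symmetric]) (simp_all add: fps_inv, simp add: fps_inv_def)
  then have "fps_deriv P = (fps_deriv Q oo a) * fps_deriv a"
    using fps_compose_deriv[OF a0, of Q] by simp
  then have "(fps_deriv P * F ^ Suc n) $ n
      = (\<Sum>k\<le>n. fps_deriv Q $ k * (a ^ k * (fps_deriv a * F ^ Suc n)) $ n)"
    using fps_compose_mult_nth[OF a0] by (simp add: mult.assoc)
  also have "\<dots> = (\<Sum>k\<le>n. if k = n then fps_deriv Q $ n else 0)"
  proof (intro sum.cong refl)
    fix k assume "k \<in> {..n}"
    then have k: "k \<le> n" by simp
    \<comment> \<open>Since a^k F^k = X^k, the k-th term is the residue coefficient of order n - k,
      which vanishes unless k = n.\<close>
    have "a ^ k * (fps_deriv a * F ^ Suc n)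
        = fps_X ^ k * (fps_deriv a * F ^ Suc (n - k)) * (G * F) ^ k"
    proof -
      have "F ^ Suc n = F ^ k * F ^ Suc (n - k)"
        using k by (simp flip: power_add)
      then show ?thesis
        by (simp only: a_def power_mult_distrib mult_ac)
    qed
    then have "(a ^ k * (fps_deriv a * F ^ Suc n)) $ n
        = (fps_deriv a * F ^ Suc (n - k)) $ (n - k)"
      using k by (simp only: GF power_one mult_1_right mult.assoc fps_X_power_mult_nth) simp
    also have "\<dots> = (if k = n then 1 else 0)"
      using residue_lagrange[OF GF, of "n - k"] k arg_cong[OF GF, of "\<lambda>f. f $ 0"]
      by (auto simp: a_def)
    finally show "fps_deriv Q $ k * (a ^ k * (fps_deriv a * F ^ Suc n)) $ n
        = (if k = n then fps_deriv Q $ n else 0)" by simp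
  qed
  also have "\<dots> = real (Suc n) * Q $ Suc n"
    by (simp del: of_nat_Suc)
  finally show ?thesis by (simp add: Q_def a_def)
qed

text \<open>Elementary form of Cauchy's estimate at radius r: the weighted coefficient sum cut off
  at n is submultiplicative, because coefficients of a product up to order n only involve
  coefficients of the factors up to order n. The cut-off keeps all sums finite.\<close>

lemma fps_power_nth_le:
  fixes F :: "real fps"
  assumes r: "r > 0" and S: "(\<Sum>m\<le>n. \<bar>F $ m\<bar> * r ^ m) \<le> S"
  shows "\<bar>(F ^ k) $ n\<bar> \<le> S ^ k / r ^ n"
proof -
  have S0: "S \<ge> 0"
    using S r by (meson abs_ge_zero mult_nonneg_nonneg order_trans sum_nonneg zero_le_power less_imp_le)
  have "(\<Sum>m\<le>n. \<bar>(F ^ k) $ m\<bar> * r ^ m) \<le> S ^ k"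
  proof (induction k)
    case 0
    have "(\<Sum>m\<le>n. \<bar>(F ^ 0) $ m\<bar> * r ^ m) = (\<Sum>m\<le>n. if m = 0 then 1 else 0)"
      by (intro sum.cong) auto
    then show ?case by simp
  next
    case (Suc k)
    have "(\<Sum>m\<le>n. \<bar>(F ^ Suc k) $ m\<bar> * r ^ m)
        \<le> (\<Sum>m\<le>n. \<Sum>i\<le>m. (\<bar>F $ i\<bar> * r ^ i) * (\<bar>(F ^ k) $ (m - i)\<bar> * r ^ (m - i)))"
    proof (rule sum_mono)
      fix m
      have "\<bar>(F ^ Suc k) $ m\<bar> \<le> (\<Sum>i\<le>m. \<bar>F $ i\<bar> * \<bar>(F ^ k) $ (m - i)\<bar>)"
        by (simp add: fps_mult_nth atLeast0AtMost abs_mult[symmetric])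
      then have "\<bar>(F ^ Suc k) $ m\<bar> * r ^ m \<le> (\<Sum>i\<le>m. \<bar>F $ i\<bar> * \<bar>(F ^ k) $ (m - i)\<bar>) * r ^ m"
        using r by (intro mult_right_mono) auto
      also have "\<dots> = (\<Sum>i\<le>m. (\<bar>F $ i\<bar> * r ^ i) * (\<bar>(F ^ k) $ (m - i)\<bar> * r ^ (m - i)))"
        unfolding sum_distrib_right
      proof (intro sum.cong refl)
        fix i assume "i \<in> {..m}"
        then have "r ^ m = r ^ i * r ^ (m - i)" by (simp flip: power_add)
        then show "\<bar>F $ i\<bar> * \<bar>(F ^ k) $ (m - i)\<bar> * r ^ m
            = (\<bar>F $ i\<bar> * r ^ i) * (\<bar>(F ^ k) $ (m - i)\<bar> * r ^ (m - i))" by simp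
      qed
      finally show "\<bar>(F ^ Suc k) $ m\<bar> * r ^ m
        \<le> (\<Sum>i\<le>m. (\<bar>F $ i\<bar> * r ^ i) * (\<bar>(F ^ k) $ (m - i)\<bar> * r ^ (m - i)))" .
    qed
    also have "\<dots> = (\<Sum>(i, j)\<in>{(i, j). i + j \<le> n}. (\<bar>F $ i\<bar> * r ^ i) * (\<bar>(F ^ k) $ j\<bar> * r ^ j))"
      by (rule sum.triangle_reindex_eq[symmetric])
    also have "\<dots> \<le> (\<Sum>(i, j)\<in>{..n} \<times> {..n}. (\<bar>F $ i\<bar> * r ^ i) * (\<bar>(F ^ k) $ j\<bar> * r ^ j))"
      using r by (intro sum_mono2) auto
    also have "\<dots> = (\<Sum>m\<le>n. \<bar>F $ m\<bar> * r ^ m) * (\<Sum>m\<le>n. \<bar>(F ^ k) $ m\<bar> * r ^ m)"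
      by (simp add: sum_product sum.cartesian_product)
    also have "\<dots> \<le> S * S ^ k"
      using S0 Suc S r by (intro mult_mono) (auto intro!: sum_nonneg)
    finally show ?case by simp
  qed
  moreover have "\<bar>(F ^ k) $ n\<bar> * r ^ n \<le> (\<Sum>m\<le>n. \<bar>(F ^ k) $ m\<bar> * r ^ m)"
    using r by (intro member_le_sum[of n "{..n}" "\<lambda>m. \<bar>(F ^ k) $ m\<bar> * r ^ m"]) auto
  ultimately show ?thesis using r by (simp add: field_simps)
qed

text \<open>
  Up to the factor \<open>C\<^sup>k\<close>, a bound for the \<open>k\<close>-th coefficient of the \<open>n\<close>-point function divided by
  \<open>\<rho>\<close>: the coefficient of \<open>z\<^sup>k\<close> in \<open>(u exp (T(u z)))\<^sup>n\<^sup>-\<^sup>1\<close>, where \<open>T = z exp T\<close> is the tree function.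
\<close>
definition maj :: "real \<Rightarrow> nat \<Rightarrow> nat \<Rightarrow> real" where
  "maj u n k = (if n = 1 then (if k = 0 then 1 else 0)
     else u ^ (n + k - 1) * real (n - 1) * real (n + k - 1) ^ k / (real (n + k - 1) * fact k))"

section \<open>Abel-type identities for the majorant\<close>

lemma sum_binomial_weighted:
  fixes N :: real
  shows "(\<Sum>j\<le>k. real (k choose j) * real j * N ^ (k - j)) = real k * (N + 1) ^ (k - 1)"
proof (cases k)
  case (Suc l)
  have "(\<Sum>j\<le>k. real (k choose j) * real j * N ^ (k - j))
      = (\<Sum>j\<le>l. real (Suc l choose Suc j) * real (Suc j) * N ^ (l - j))"
    unfolding Suc by (subst sum.atMost_Suc_shift) simp
  also have "\<dots> = (\<Sum>j\<le>l. real (Suc l) * (real (l choose j) * N ^ (l - j)))"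
  proof (intro sum.cong refl)
    fix j
    have "real (Suc l choose Suc j) * real (Suc j) = real (Suc l) * real (l choose j)"
      unfolding of_nat_mult[symmetric] by (metis Suc_times_binomial_eq mult.commute)
    then show "real (Suc l choose Suc j) * real (Suc j) * N ^ (l - j)
        = real (Suc l) * (real (l choose j) * N ^ (l - j))" by (metis mult.assoc)
  qed
  also have "\<dots> = real k * (N + 1) ^ (k - 1)"
    using binomial_ring[of 1 N l] by (simp add: Suc sum_distrib_left[symmetric] add.commute)
  finally show ?thesis .
qed simp

lemma sum_binomial_linear:
  fixes N a :: real
  shows "(\<Sum>j\<le>k. real (k choose j) * (a + real j) * N ^ (k - j))
    = a * (N + 1) ^ k + real k * (N + 1) ^ (k - 1)"
proof -
  have "(\<Sum>j\<le>k. real (k choose j) * (a + real j) * N ^ (k - j))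
     = a * (\<Sum>j\<le>k. real (k choose j) * 1 ^ j * N ^ (k - j)) + (\<Sum>j\<le>k. real (k choose j) * real j * N ^ (k - j))"
    by (simp add: sum_distrib_left sum.distrib[symmetric] algebra_simps)
  then show ?thesis
    using binomial_ring[of 1 N k] by (simp add: sum_binomial_weighted add.commute)
qed

lemma fact_choose_div: "j \<le> k \<Longrightarrow> 1 / (fact j * fact (k - j)) = real (k choose j) / fact k"
  by (simp add: binomial_fact field_simps)

text \<open>Coefficient form of y^(n-1) = u y^(n-2) exp(z y) for y = u exp(T(u z)). It is the
  recursion that closes the induction in \<open>abs_ncorr_le\<close>.\<close>

lemma maj_rec:
  assumes "n \<ge> 2"
  shows "maj u n k = u * (\<Sum>j\<le>k. maj u (n - 1 + j) (k - j) / fact j)"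
proof (cases "n = 2 \<and> k = 0")
  \<comment> \<open>The only case in which the number N below is 0, so that dividing by it would
    give a wrong value.\<close>
  case True then show ?thesis by (simp add: maj_def)
next
  case False
  define N :: real where "N = real (n + k - 2)"
  have N: "N > 0" "real (n + k - 1) = N + 1" using assms False by (auto simp: N_def of_nat_diff)
  have "(\<Sum>j\<le>k. maj u (n - 1 + j) (k - j) / fact j)
      = (\<Sum>j\<le>k. u ^ (n + k - 2) / (N * fact k) * (real (k choose j) * (real (n - 2) + real j) * N ^ (k - j)))"
  proof (intro sum.cong refl)
    fix j assume "j \<in> {..k}"
    then have j: "j \<le> k" by simp
    have *: "n - Suc 0 + k - Suc 0 = n + k - 2" "n + k - Suc (Suc 0) = n + k - 2" using assms by auto
    show "maj u (n - 1 + j) (k - j) / fact j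
      = u ^ (n + k - 2) / (N * fact k) * (real (k choose j) * (real (n - 2) + real j) * N ^ (k - j))"
    \<comment> \<open>This means n = 2 and j = 0, the one-point value set apart in
      \<open>maj\<close>; as k > 0 here, both sides are 0.\<close>
    proof (cases "n - 1 + j = 1")
      case True
      then show ?thesis using assms False j by (auto simp: maj_def)
    next
      case nt: False
      have "maj u (n - 1 + j) (k - j) / fact j
         = u ^ (n + k - 2) * (real (n - 2) + real j) * N ^ (k - j) / N * (1 / (fact j * fact (k - j)))"
        using nt j assms by (simp add: maj_def * N_def of_nat_diff add_diff_eq mult_ac)
      then show ?thesis unfolding fact_choose_div[OF j] by simp
    qed
  qed
  also have "\<dots> = u ^ (n + k - 2) / (N * fact k) * (real (n - 2) * (N + 1) ^ k + real k * (N + 1) ^ (k - 1))"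
    unfolding sum_distrib_left[symmetric] sum_binomial_linear ..
  also have "real (n - 2) * (N + 1) ^ k + real k * (N + 1) ^ (k - 1) = N * real (n - 1) * (N + 1) ^ k / (N + 1)"
  proof (cases k)
    case 0 then show ?thesis using assms N False by (simp add: N_def of_nat_diff)
  next
    case (Suc l)
    have "real (n - 2) * (N + 1) + real k = N * real (n - 1)"
      using assms by (simp add: N_def of_nat_diff algebra_simps)
    then have "(N + 1) ^ l * (real (n - 2) * (N + 1) + real k) = (N + 1) ^ l * (N * real (n - 1))"
      by simp
    then have "real (n - 2) * (N + 1) ^ k + real k * (N + 1) ^ (k - 1) = N * real (n - 1) * (N + 1) ^ l"
      by (simp add: Suc algebra_simps)
    also have "\<dots> = N * real (n - 1) * (N + 1) ^ k / (N + 1)"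
      using N by (simp add: Suc)
    finally show ?thesis .
  qed
  finally have R: "(\<Sum>j\<le>k. maj u (n - 1 + j) (k - j) / fact j)
      = u ^ (n + k - 2) / (N * fact k) * (N * real (n - 1) * (N + 1) ^ k / (N + 1))" .
  have "n + k - 1 = Suc (n + k - 2)" using assms by simp
  then have "u ^ (n + k - 1) = u * u ^ (n + k - 2)" by simp
  then have "maj u n k = u * u ^ (n + k - 2) * real (n - 1) * (N + 1) ^ k / ((N + 1) * fact k)"
    unfolding maj_def N(2) using assms by simp
  then show ?thesis unfolding R using N(1) by (simp add: mult_ac)
qed

text \<open>With y = u exp(T(u z)) the left side is the coefficient of (exp(z y) - 1) / y = 1/u -
  1/y = T1(u z) / u. Computationally it is \<open>sum_binomial_linear\<close> at a = -1: the sum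
  from j = 0 vanishes, so the sum from j = 1 is minus the term j = 0.\<close>

lemma maj_sum:
  assumes "m \<ge> 1"
  shows "(\<Sum>j=1..m. maj u j (m - j) / fact j) = u ^ (m - 1) * real (m - 1) ^ (m - 1) / fact m"
proof (cases "m = 1")
  case True then show ?thesis by (simp add: maj_def)
next
  case False
  define N :: real where "N = real (m - 1)"
  have N: "N > 0" "N + 1 = real m" using assms False by (auto simp: N_def of_nat_diff)
  have "(\<Sum>j=1..m. maj u j (m - j) / fact j)
      = (\<Sum>j=1..m. u ^ (m - 1) / (N * fact m) * (real (m choose j) * (-1 + real j) * N ^ (m - j)))"
  proof (intro sum.cong refl)
    fix j assume "j \<in> {1..m}"
    then have j: "j \<le> m" "j \<ge> 1" by simp_all
    show "maj u j (m - j) / fact j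
      = u ^ (m - 1) / (N * fact m) * (real (m choose j) * (-1 + real j) * N ^ (m - j))"
    proof (cases "j = 1")
      case True
      then show ?thesis using assms False j by (auto simp: maj_def)
    next
      case nt: False
      have "maj u j (m - j) / fact j
         = u ^ (m - 1) * (-1 + real j) * N ^ (m - j) / N * (1 / (fact j * fact (m - j)))"
        using nt j assms by (simp add: maj_def N_def of_nat_diff)
      then show ?thesis unfolding fact_choose_div[OF j(1)] by simp
    qed
  qed
  also have "\<dots> = u ^ (m - 1) / (N * fact m) * ((\<Sum>j\<le>m. real (m choose j) * (-1 + real j) * N ^ (m - j)) + N ^ m)"
    by (simp add: sum_distrib_left sum.atMost_shift atLeast0AtMost[symmetric] sum.atLeast_Suc_atMost mult.assoc)
  also have "(\<Sum>j\<le>m. real (m choose j) * (-1 + real j) * N ^ (m - j)) = 0"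
    unfolding sum_binomial_linear N(2) using assms by (cases m) simp_all
  finally show ?thesis using N assms
    by (cases m) (simp_all add: N_def)
qed

section \<open>The series of T1\<close>

lemma T1_summable:
  assumes "0 \<le> z" "z < exp (- 1)"
  shows "summable (\<lambda>m. real (Suc m) ^ Suc m * z ^ (m + 2) / fact (m + 2))"
proof (rule summable_comparison_test')
  have "z * exp 1 < 1" using assms(2) by (simp add: exp_minus field_simps)
  then show "summable (\<lambda>m. (z * exp 1) ^ m * exp 1)"
    using assms by (intro summable_mult2 summable_geometric) auto
next
  fix m :: nat
  \<comment> \<open>One term of the exponential series at n is at most its sum; this is the origin
    of the radius 1/e.\<close>
  have e: "real n ^ n / fact n \<le> exp (real n)" for n
  proof -
    have "(\<Sum>i\<in>{n}. real n ^ i / fact i) \<le> (\<Sum>i. real n ^ i / fact i)"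
      by (intro sum_le_suminf) (auto intro!: summable_exp[of "real n", simplified divide_inverse_commute[symmetric]])
    then show ?thesis
      by (simp add: exp_def divide_inverse mult.commute scaleR_conv_of_real)
  qed
  have z1: "z \<le> 1" using assms(2) by (simp add: less_le_trans less_imp_le)
  have "real (Suc m) ^ Suc m * z ^ (m + 2) / fact (m + 2)
      = real (Suc m) ^ Suc m / fact (Suc m) * z ^ (m + 2) / (real m + 2)"
    by (simp add: field_simps)
  also have "\<dots> \<le> exp (real (Suc m)) * z ^ m / 1"
    using assms z1 e[of "Suc m"] by (intro frac_le mult_mono power_decreasing) (auto simp del: power_Suc)
  also have "\<dots> = (z * exp 1) ^ m * exp 1"
    by (simp add: exp_add power_mult_distrib exp_of_nat_mult[symmetric] mult.commute)
  finally show "norm (real (Suc m) ^ Suc m * z ^ (m + 2) / fact (m + 2)) \<le> (z * exp 1) ^ m * exp 1"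
    using assms by simp
qed

lemma T1_partial_sum:
  assumes "u > 0" "0 \<le> c" "u * c < exp (- 1)"
  shows "(\<Sum>m=1..n. u ^ (m - 1) * real (m - 1) ^ (m - 1) / fact m * c ^ m) \<le> T1 (u * c) / u"
proof -
  define g where "g m = real (Suc m) ^ Suc m * (u * c) ^ (m + 2) / fact (m + 2)" for m
  have sg: "summable g" unfolding g_def using assms by (intro T1_summable) auto
  \<comment> \<open>One extra term makes the finite sum exactly \<open>c\<close> plus n terms of the
    series: the term m = 1 is \<open>c\<close>, by 0^0 = 1, and the term m + 2 is
    \<open>g m / u\<close>.\<close>
  have "(\<Sum>m=1..n. u ^ (m - 1) * real (m - 1) ^ (m - 1) / fact m * c ^ m)
     \<le> (\<Sum>m=1..n + 1. u ^ (m - 1) * real (m - 1) ^ (m - 1) / fact m * c ^ m)"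
    using assms by (intro sum_mono2) auto
  also have "\<dots> = c + (\<Sum>m<n. g m) / u"
  proof (induction n)
    case (Suc n)
    have "u ^ Suc n * real (Suc n) ^ Suc n / fact (n + 2) * c ^ (n + 2) = g n / u"
      using assms by (simp add: g_def power_mult_distrib)
    with Suc show ?case by (simp add: add_divide_distrib)
  qed simp
  also have "\<dots> \<le> c + (\<Sum>m. g m) / u"
    using assms sg by (intro add_left_mono divide_right_mono sum_le_suminf sg) (use assms in \<open>auto simp: g_def\<close>)
  also have "\<dots> = T1 (u * c) / u"
    using assms unfolding T1_def g_def by (simp add: add_divide_distrib)
  finally show ?thesis .
qed

section \<open>Rooted graph sums\<close>

definition edges :: "nat set \<Rightarrow> (nat \<times> nat) set" where
  "edges V = {(i, j). i < j \<and> i \<in> V \<and> j \<in> V}"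

text \<open>These graphs expand the correlation function of the points in \<open>A\<close>, with the
  points in \<open>Y\<close> integrated. Edges between roots are allowed and sum up to the Boltzmann
  factor of the roots; the roots need not be connected to each other.\<close>

definition rooted_graphs :: "nat set \<Rightarrow> nat set \<Rightarrow> (nat \<times> nat) set set" where
  "rooted_graphs A Y = {E. E \<subseteq> edges (A \<union> Y) \<and> Y \<subseteq> (E \<union> E\<inverse>)\<^sup>* `` A}"

definition graph_sum :: "('a::euclidean_space \<Rightarrow> real) \<Rightarrow> nat set \<Rightarrow> nat set \<Rightarrow> (nat \<Rightarrow> 'a) \<Rightarrow> real" where
  "graph_sum f A Y x = (\<Sum>E\<in>rooted_graphs A Y. \<Prod>(i, j)\<in>E. f (x i - x j))"

lemma finite_edges: "finite V \<Longrightarrow> finite (edges V)"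
  by (rule finite_subset[of _ "V \<times> V"]) (auto simp: edges_def)

lemma finite_rooted_graphs: "finite A \<Longrightarrow> finite Y \<Longrightarrow> finite (rooted_graphs A Y)"
  by (rule finite_subset[of _ "Pow (edges (A \<union> Y))"]) (auto simp: rooted_graphs_def finite_edges)

lemma graph_sum_cong:
  assumes "\<And>i. i \<in> A \<union> Y \<Longrightarrow> x i = x' i"
  shows "graph_sum f A Y x = graph_sum f A Y x'"
  unfolding graph_sum_def rooted_graphs_def edges_def
  by (intro sum.cong prod.cong refl) (use assms in \<open>auto simp: subset_iff\<close>)

lemma graph_sum_translate: "graph_sum f A Y (\<lambda>i. x i + v) = graph_sum f A Y x"
  by (simp add: graph_sum_def)

lemma rooted_graphs_empty_roots: "rooted_graphs {} Y = (if Y = {} then {{}} else {})"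
  by (auto simp: rooted_graphs_def edges_def)

lemma graph_sum_empty_roots: "graph_sum f {} Y x = (if Y = {} then 1 else 0)"
  by (simp add: graph_sum_def rooted_graphs_empty_roots)

lemma conn_graphs_eq: "n \<ge> 1 \<Longrightarrow> conn_graphs n = rooted_graphs {0} {1..<n}"
proof -
  assume n: "n \<ge> 1"
  then have "edges ({0} \<union> {1..<n}) = {(i, j). i < j \<and> j < n}"
    by (auto simp: edges_def)
  moreover have "{1..<n} \<subseteq> R\<^sup>* `` {0} \<longleftrightarrow> (\<forall>k<n. (0, k) \<in> R\<^sup>*)" for R :: "(nat \<times> nat) set"
    by (auto simp: subset_iff Ball_def Suc_le_eq) (metis neq0_conv rtrancl.rtrancl_refl)
  ultimately show ?thesis
    unfolding conn_graphs_def rooted_graphs_def by simp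
qed

section \<open>Deleting a root from a graph\<close>

definition mk_edge :: "nat \<Rightarrow> nat \<Rightarrow> nat \<times> nat" where
  "mk_edge a b = (min a b, max a b)"

lemma mk_edge_inj: "mk_edge a b = mk_edge a c \<longleftrightarrow> b = c"
  by (auto simp: mk_edge_def min_def max_def split: if_splits)

lemma mk_edge_in_sym: "mk_edge a b \<in> E \<Longrightarrow> (a, b) \<in> E \<union> E\<inverse>"
  by (auto simp: mk_edge_def min_def max_def split: if_splits)

lemma mk_edge_in_edges: "a \<noteq> b \<Longrightarrow> a \<in> V \<Longrightarrow> b \<in> V \<Longrightarrow> mk_edge a b \<in> edges V"
  by (auto simp: edges_def mk_edge_def min_def max_def)

lemma mk_edge_notin_edges: "a \<notin> V \<Longrightarrow> mk_edge a b \<notin> edges V"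
  by (auto simp: edges_def mk_edge_def min_def max_def split: if_splits)

text \<open>A path leaving \<open>a\<close> enters \<open>A\<close> or \<open>S\<close> at its next
  vertex. Vertices of \<open>A\<close> are roots already, so edges from \<open>a\<close> to them
  make nothing new reachable, whereas the vertices of \<open>S\<close> have to become roots once
  \<open>a\<close> is gone.\<close>

lemma reach_delete_root:
  fixes a :: nat
  assumes E: "E \<subseteq> edges (A \<union> Y)" and a: "a \<notin> A \<union> Y" and T: "T \<subseteq> A" and S: "S \<subseteq> Y"
    and AY: "A \<inter> Y = {}"
  defines "E' \<equiv> E \<union> mk_edge a ` (T \<union> S)"
  shows "Y \<subseteq> (E' \<union> E'\<inverse>)\<^sup>* `` insert a A \<longleftrightarrow> Y - S \<subseteq> (E \<union> E\<inverse>)\<^sup>* `` (A \<union> S)"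
proof
  assume L: "Y \<subseteq> (E' \<union> E'\<inverse>)\<^sup>* `` insert a A"
  have step: "(E' \<union> E'\<inverse>)\<^sup>* `` insert a A \<subseteq> insert a ((E \<union> E\<inverse>)\<^sup>* `` (A \<union> S))"
  proof
    fix y assume "y \<in> (E' \<union> E'\<inverse>)\<^sup>* `` insert a A"
    then obtain r where r: "r \<in> insert a A" "(r, y) \<in> (E' \<union> E'\<inverse>)\<^sup>*" by blast
    from r(2) show "y \<in> insert a ((E \<union> E\<inverse>)\<^sup>* `` (A \<union> S))"
    proof (induction rule: rtrancl_induct)
      case base
      then show ?case using r(1) by blast
    next
      case (step y z)
      show ?case
      proof (cases "(y, z) \<in> E \<union> E\<inverse>")
        case True
        then have "y \<noteq> a" using E a by (auto simp: edges_def)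
        then show ?thesis using step.IH True by (auto intro: rtrancl_into_rtrancl)
      next
        case False
        then have "(y, z) \<in> mk_edge a ` (T \<union> S) \<union> (mk_edge a ` (T \<union> S))\<inverse>"
          using step.hyps(2) by (auto simp: E'_def)
        then have "z = a \<or> z \<in> T \<union> S"
          by (auto simp: mk_edge_def min_def max_def split: if_splits)
        then show ?thesis using T by auto
      qed
    qed
  qed
  show "Y - S \<subseteq> (E \<union> E\<inverse>)\<^sup>* `` (A \<union> S)"
    using L step a by blast
next
  assume R: "Y - S \<subseteq> (E \<union> E\<inverse>)\<^sup>* `` (A \<union> S)"
  have mono: "(E \<union> E\<inverse>)\<^sup>* \<subseteq> (E' \<union> E'\<inverse>)\<^sup>*"
    by (rule rtrancl_mono) (auto simp: E'_def)
  have aS: "(a, s) \<in> (E' \<union> E'\<inverse>)\<^sup>*" if "s \<in> S" for s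
    using mk_edge_in_sym[of a s E'] that by (auto simp: E'_def)
  show "Y \<subseteq> (E' \<union> E'\<inverse>)\<^sup>* `` insert a A"
  proof
    fix y assume y: "y \<in> Y"
    show "y \<in> (E' \<union> E'\<inverse>)\<^sup>* `` insert a A"
    proof (cases "y \<in> S")
      case True then show ?thesis using aS by blast
    next
      case False
      with R y obtain r where "r \<in> A \<union> S" "(r, y) \<in> (E' \<union> E'\<inverse>)\<^sup>*" using mono by blast
      then show ?thesis using aS by (blast intro: rtrancl_trans)
    qed
  qed
qed

text \<open>A graph amounts to the neighbours \<open>T\<close> of \<open>a\<close> among the roots,
  its neighbours \<open>S\<close> in \<open>Y\<close>, and the remaining edges. \<open>T\<close> is
  an unconstrained subset of \<open>A\<close>, which later turns the sum over it into a product of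
  factors 1 + f.\<close>

lemma bij_betw_delete_root:
  assumes a: "a \<notin> A \<union> Y" and AY: "A \<inter> Y = {}"
  shows "bij_betw (\<lambda>(T, S, E). E \<union> mk_edge a ` (T \<union> S))
    (SIGMA T:Pow A. SIGMA S:Pow Y. rooted_graphs (A \<union> S) (Y - S)) (rooted_graphs (insert a A) Y)"
    (is "bij_betw ?h ?D ?R")
proof (rule bij_betw_byWitness[where f' = "\<lambda>E. ({b\<in>A. mk_edge a b \<in> E}, {b\<in>Y. mk_edge a b \<in> E}, E \<inter> edges (A \<union> Y))"])
  have un: "A \<union> S \<union> (Y - S) = A \<union> Y" if "S \<subseteq> Y" for S using that by blast
  note ne = mk_edge_notin_edges[OF a]
  show "\<forall>d\<in>?D. (\<lambda>E. ({b \<in> A. mk_edge a b \<in> E}, {b \<in> Y. mk_edge a b \<in> E}, E \<inter> edges (A \<union> Y))) (?h d) = d"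
    using ne AY by (auto simp: rooted_graphs_def un mk_edge_inj image_iff)
  have dec: "E = (E \<inter> edges (A \<union> Y)) \<union> mk_edge a ` ({b \<in> A. mk_edge a b \<in> E} \<union> {b \<in> Y. mk_edge a b \<in> E})"
    if "E \<subseteq> edges (insert a A \<union> Y)" for E
  proof (intro equalityI subsetI)
    fix e assume e: "e \<in> E"
    obtain i j where ij: "e = (i, j)" by (cases e)
    have *: "i < j" "i \<in> insert a A \<union> Y" "j \<in> insert a A \<union> Y"
      using that e ij by (auto simp: edges_def)
    consider "i = a" | "j = a" | "i \<noteq> a" "j \<noteq> a" by blast
    then show "e \<in> (E \<inter> edges (A \<union> Y)) \<union> mk_edge a ` ({b \<in> A. mk_edge a b \<in> E} \<union> {b \<in> Y. mk_edge a b \<in> E})"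
    proof cases
      case 1
      then have "e = mk_edge a j" "j \<in> A \<union> Y" using * ij by (auto simp: mk_edge_def)
      then show ?thesis using e by auto
    next
      case 2
      then have "e = mk_edge a i" "i \<in> A \<union> Y" using * ij by (auto simp: mk_edge_def)
      then show ?thesis using e by auto
    next
      case 3
      then show ?thesis using * ij e by (auto simp: edges_def)
    qed
  qed auto
  show "\<forall>E\<in>?R. ?h ({b \<in> A. mk_edge a b \<in> E}, {b \<in> Y. mk_edge a b \<in> E}, E \<inter> edges (A \<union> Y)) = E"
    using dec by (auto simp: rooted_graphs_def)
  show "?h ` ?D \<subseteq> ?R"
  proof clarify
    fix T S E assume *: "T \<subseteq> A" "S \<subseteq> Y" "E \<in> rooted_graphs (A \<union> S) (Y - S)"
    have E: "E \<subseteq> edges (A \<union> Y)" using * by (simp add: rooted_graphs_def un)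
    have "E \<union> mk_edge a ` (T \<union> S) \<subseteq> edges (insert a A \<union> Y)"
    proof (rule Un_least)
      show "E \<subseteq> edges (insert a A \<union> Y)" using E by (auto simp: edges_def)
      show "mk_edge a ` (T \<union> S) \<subseteq> edges (insert a A \<union> Y)"
        using * a by (intro image_subsetI mk_edge_in_edges) auto
    qed
    then show "E \<union> mk_edge a ` (T \<union> S) \<in> rooted_graphs (insert a A) Y"
      using reach_delete_root[OF E a *(1,2) AY] * by (simp add: rooted_graphs_def)
  qed
  show "(\<lambda>E. ({b \<in> A. mk_edge a b \<in> E}, {b \<in> Y. mk_edge a b \<in> E}, E \<inter> edges (A \<union> Y))) ` ?R \<subseteq> ?D"
  proof (rule image_subsetI)
    fix E assume E: "E \<in> ?R"
    let ?T = "{b \<in> A. mk_edge a b \<in> E}" and ?S = "{b \<in> Y. mk_edge a b \<in> E}" and ?E = "E \<inter> edges (A \<union> Y)"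
    have d: "?E \<union> mk_edge a ` (?T \<union> ?S) = E"
      using dec[of E] E by (simp add: rooted_graphs_def)
    have "Y - ?S \<subseteq> (?E \<union> ?E\<inverse>)\<^sup>* `` (A \<union> ?S)"
      using reach_delete_root[OF _ a _ _ AY, of ?E ?T ?S, unfolded d] E
      by (simp add: rooted_graphs_def)
    then show "(?T, ?S, ?E) \<in> ?D"
      by (auto simp: rooted_graphs_def un)
  qed
qed

lemma prod_one_plus: "finite A \<Longrightarrow> (\<Prod>j\<in>A. 1 + g j) = (\<Sum>T\<in>Pow A. \<Prod>j\<in>T. g j)"
  for g :: "'b \<Rightarrow> real"
  using prod_add[of A g "\<lambda>_. 1"] by (simp add: add.commute)

text \<open>The pointwise Kirkwood--Salsburg equation: delete the root \<open>a\<close>, whose neighbours \<open>S\<close> in \<open>Y\<close> become roots.\<close>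
lemma graph_sum_insert_root:
  assumes a: "a \<notin> A \<union> Y" and AY: "A \<inter> Y = {}" and fin: "finite A" "finite Y"
    and even: "\<And>v. f (- v) = f v"
  shows "graph_sum f (insert a A) Y x =
    (\<Prod>j\<in>A. 1 + f (x a - x j)) *
    (\<Sum>S\<in>Pow Y. (\<Prod>s\<in>S. f (x a - x s)) * graph_sum f (A \<union> S) (Y - S) x)"
proof -
  let ?w = "\<lambda>E. \<Prod>(i, j)\<in>E. f (x i - x j)"
  have even': "f (x i - x j) = f (x j - x i)" for i j
    using even[of "x i - x j"] by simp
  have w: "?w (E \<union> mk_edge a ` (T \<union> S)) = (\<Prod>j\<in>T. f (x a - x j)) * ((\<Prod>s\<in>S. f (x a - x s)) * ?w E)"
    if "T \<subseteq> A" "S \<subseteq> Y" "E \<in> rooted_graphs (A \<union> S) (Y - S)" for T S E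
  proof -
    have E: "E \<subseteq> edges (A \<union> Y)"
      using that by (auto simp: rooted_graphs_def edges_def subset_iff)
    have fins: "finite E" "finite T" "finite S"
      using E fin that finite_subset finite_edges[of "A \<union> Y"] by auto
    have "E \<inter> mk_edge a ` (T \<union> S) = {}"
      using E mk_edge_notin_edges[OF a] by blast
    then have "?w (E \<union> mk_edge a ` (T \<union> S)) = ?w E * ?w (mk_edge a ` (T \<union> S))"
      using fins by (intro prod.union_disjoint) auto
    \<comment> \<open>Edges are stored with the smaller end first; evenness of \<open>f\<close>
      allows every difference to be written as \<open>x a - x s\<close>.\<close>
    also have "?w (mk_edge a ` (T \<union> S)) = (\<Prod>s\<in>T \<union> S. f (x a - x s))"
      by (subst prod.reindex) (auto simp: inj_on_def mk_edge_inj mk_edge_def min_def max_def even' intro!: prod.cong)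
    also have "\<dots> = (\<Prod>j\<in>T. f (x a - x j)) * (\<Prod>s\<in>S. f (x a - x s))"
      using fins that AY by (intro prod.union_disjoint) auto
    finally show ?thesis by simp
  qed
  have finR: "finite (rooted_graphs (A \<union> S) (Y - S))" if "S \<subseteq> Y" for S
    using that fin by (intro finite_rooted_graphs) (auto intro: finite_subset)
  have "graph_sum f (insert a A) Y x =
    (\<Sum>(T, S, E)\<in>(SIGMA T:Pow A. SIGMA S:Pow Y. rooted_graphs (A \<union> S) (Y - S)). ?w (E \<union> mk_edge a ` (T \<union> S)))"
    unfolding graph_sum_def
    by (subst sum.reindex_bij_betw[OF bij_betw_delete_root[OF a AY], symmetric]) (simp add: case_prod_unfold)
  also have "\<dots> = (\<Sum>T\<in>Pow A. \<Sum>S\<in>Pow Y. \<Sum>E\<in>rooted_graphs (A \<union> S) (Y - S).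
      (\<Prod>j\<in>T. f (x a - x j)) * ((\<Prod>s\<in>S. f (x a - x s)) * ?w E))"
    using fin finR
    by (subst sum.Sigma[symmetric]; (subst sum.Sigma[symmetric])?)
       (auto intro!: sum.cong w finite_SigmaI)
  also have "\<dots> = (\<Sum>T\<in>Pow A. \<Prod>j\<in>T. f (x a - x j)) *
    (\<Sum>S\<in>Pow Y. (\<Prod>s\<in>S. f (x a - x s)) * graph_sum f (A \<union> S) (Y - S) x)"
    by (simp add: graph_sum_def sum_distrib_left[symmetric] sum_distrib_right[symmetric])
  finally show ?thesis using fin by (simp add: prod_one_plus)
qed

text \<open>A relabelling need not preserve the order i < j in which edges are stored, so graphs are
  not mapped directly. Root deletion speaks only of sets of labels, and induction on the number of
  vertices transports the identity.\<close>

lemma graph_sum_relabel: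
  assumes "finite A" "finite Y" "A \<inter> Y = {}" "inj_on \<pi> (A \<union> Y)" and even: "\<And>v. f (- v) = f v"
  shows "graph_sum f (\<pi> ` A) (\<pi> ` Y) x = graph_sum f A Y (x \<circ> \<pi>)"
  using assms(1-4)
proof (induction "card (A \<union> Y)" arbitrary: A Y rule: less_induct)
  case less
  show ?case
  proof (cases "A = {}")
    case True then show ?thesis by (simp add: graph_sum_empty_roots)
  next
    case False
    then obtain a A' where A: "A = insert a A'" "a \<notin> A'" by (metis Set.set_insert ex_in_conv)
    have inj: "inj_on \<pi> Y" "inj_on \<pi> A'" "inj_on \<pi> (A' \<union> Y)"
      using less.prems(4) A by (auto simp: inj_on_Un)
    have d: "\<pi> a \<notin> \<pi> ` A' \<union> \<pi> ` Y" "\<pi> ` A' \<inter> \<pi> ` Y = {}"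
      using less.prems(3,4) A by (auto simp: inj_on_def)
    have dY: "\<pi> ` Y - \<pi> ` S = \<pi> ` (Y - S)" if "S \<subseteq> Y" for S
      using inj(1) that by (simp add: inj_on_image_set_diff[of \<pi> Y])
    have "graph_sum f (\<pi> ` A) (\<pi> ` Y) x = (\<Prod>j\<in>\<pi> ` A'. 1 + f (x (\<pi> a) - x j)) *
      (\<Sum>S\<in>Pow (\<pi> ` Y). (\<Prod>s\<in>S. f (x (\<pi> a) - x s)) * graph_sum f (\<pi> ` A' \<union> S) (\<pi> ` Y - S) x)"
      using less.prems A by (simp add: graph_sum_insert_root[where f = f, OF d _ _ even])
    also have "(\<Prod>j\<in>\<pi> ` A'. 1 + f (x (\<pi> a) - x j)) = (\<Prod>j\<in>A'. 1 + f ((x \<circ> \<pi>) a - (x \<circ> \<pi>) j))"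
      using inj by (simp add: prod.reindex)
    also have "(\<Sum>S\<in>Pow (\<pi> ` Y). (\<Prod>s\<in>S. f (x (\<pi> a) - x s)) * graph_sum f (\<pi> ` A' \<union> S) (\<pi> ` Y - S) x)
      = (\<Sum>S\<in>Pow Y. (\<Prod>s\<in>\<pi> ` S. f (x (\<pi> a) - x s)) * graph_sum f (\<pi> ` A' \<union> \<pi> ` S) (\<pi> ` Y - \<pi> ` S) x)"
      using inj by (simp add: image_Pow_surj[symmetric] sum.reindex[OF inj_on_image_Pow] del: image_Pow_surj)
    also have "\<dots> = (\<Sum>S\<in>Pow Y. (\<Prod>s\<in>S. f ((x \<circ> \<pi>) a - (x \<circ> \<pi>) s)) * graph_sum f (A' \<union> S) (Y - S) (x \<circ> \<pi>))"
    proof (intro sum.cong refl)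
      fix S assume "S \<in> Pow Y"
      then have S: "S \<subseteq> Y" by simp
      have un: "A' \<union> S \<union> (Y - S) = A' \<union> Y" using S by auto
      have "graph_sum f (\<pi> ` (A' \<union> S)) (\<pi> ` (Y - S)) x = graph_sum f (A' \<union> S) (Y - S) (x \<circ> \<pi>)"
      proof (rule less.hyps)
        show "card (A' \<union> S \<union> (Y - S)) < card (A \<union> Y)"
          unfolding un using less.prems A by (intro psubset_card_mono) auto
      qed (use less.prems A S in \<open>auto simp: un inj(3) dest: finite_subset\<close>)
      moreover have "inj_on \<pi> S" using inj(1) S by (rule inj_on_subset)
      ultimately show "(\<Prod>s\<in>\<pi> ` S. f (x (\<pi> a) - x s)) * graph_sum f (\<pi> ` A' \<union> \<pi> ` S) (\<pi> ` Y - \<pi> ` S) x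
        = (\<Prod>s\<in>S. f ((x \<circ> \<pi>) a - (x \<circ> \<pi>) s)) * graph_sum f (A' \<union> S) (Y - S) (x \<circ> \<pi>)"
        by (simp add: dY[OF S] prod.reindex image_Un)
    qed
    also have "(\<Prod>j\<in>A'. 1 + f ((x \<circ> \<pi>) a - (x \<circ> \<pi>) j)) * \<dots> = graph_sum f A Y (x \<circ> \<pi>)"
      unfolding A(1) using less.prems A by (subst graph_sum_insert_root[where f = f, OF _ _ _ _ even]) auto
    finally show ?thesis .
  qed
qed

section \<open>Integration over configurations\<close>

abbreviation conf :: "nat set \<Rightarrow> (nat \<Rightarrow> 'a::euclidean_space) measure" where
  "conf Y \<equiv> PiM Y (\<lambda>_. lborel)"

interpretation conf: product_sigma_finite "\<lambda>_::nat. lborel :: 'a::euclidean_space measure"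
  by standard

lemma override_on_merge:
  "S \<inter> T = {} \<Longrightarrow> override_on x (merge S T (y, z)) (S \<union> T) = override_on (override_on x y S) z T"
  by (auto simp: override_on_def merge_def fun_eq_iff)

section \<open>Relabelling and translating the configuration measure\<close>

lemma emeasure_lborel_shift:
  fixes v :: "'a::euclidean_space"
  assumes "A \<in> sets borel"
  shows "emeasure lborel ((\<lambda>z. z + v) -` A) = emeasure lborel A"
proof -
  have "emeasure lborel A = emeasure (distr lborel borel ((+) v)) A"
    by (simp add: lborel_distr_plus)
  also have "\<dots> = emeasure lborel ((\<lambda>z. z + v) -` A)"
    using assms by (subst emeasure_distr) (auto simp: add.commute[of v] intro!: arg_cong[where f = "emeasure lborel"])
  finally show ?thesis ..
qed

text \<open>Both symmetries of the correlation functions, under relabelling and under a common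
  translation, rest on this identity. It is checked on boxes, which determine the product
  measure.\<close>

lemma distr_conf_relabel_shift:
  fixes v :: "'a::euclidean_space"
  assumes fin: "finite Y" and \<sigma>: "bij_betw \<sigma> Y Y'"
  shows "distr (conf Y') (conf Y) (\<lambda>y. \<lambda>j\<in>Y. y (\<sigma> j) + v) = conf Y"
proof (rule conf.PiM_eqI[OF fin])
  have finY': "finite Y'" using \<sigma> fin bij_betw_finite by blast
  have \<sigma>Y: "\<sigma> j \<in> Y'" if "j \<in> Y" for j using \<sigma> that by (auto simp: bij_betw_def)
  have meas: "(\<lambda>y. \<lambda>j\<in>Y. y (\<sigma> j) + v) \<in> measurable (conf Y') (conf Y)"
    by (rule measurable_restrict) (use \<sigma>Y in measurable)
  fix A :: "nat \<Rightarrow> 'a set" assume A: "\<And>i. i \<in> Y \<Longrightarrow> A i \<in> sets lborel"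
  let ?B = "\<lambda>i. (\<lambda>z. z + v) -` A (inv_into Y \<sigma> i)"
  have inv: "inv_into Y \<sigma> (\<sigma> j) = j" if "j \<in> Y" for j
    using \<sigma> that by (simp add: bij_betw_def)
  have invY: "inv_into Y \<sigma> i \<in> Y" "\<sigma> (inv_into Y \<sigma> i) = i" if "i \<in> Y'" for i
    using \<sigma> that by (auto simp: bij_betw_def inv_into_into f_inv_into_f)
  have pre: "(\<lambda>y. \<lambda>j\<in>Y. y (\<sigma> j) + v) -` Pi\<^sub>E Y A \<inter> space (conf Y') = Pi\<^sub>E Y' ?B"
  proof (intro set_eqI iffI)
    fix y :: "nat \<Rightarrow> 'a" assume "y \<in> (\<lambda>y. \<lambda>j\<in>Y. y (\<sigma> j) + v) -` Pi\<^sub>E Y A \<inter> space (conf Y')"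
    then have 1: "\<And>j. j \<in> Y \<Longrightarrow> y (\<sigma> j) + v \<in> A j" and 2: "y \<in> extensional Y'"
      by (auto simp: space_PiM PiE_iff)
    show "y \<in> Pi\<^sub>E Y' ?B"
      using 1[OF invY(1)] invY(2) 2 by (auto simp: PiE_iff)
  next
    fix y :: "nat \<Rightarrow> 'a" assume y: "y \<in> Pi\<^sub>E Y' ?B"
    then have "y (\<sigma> j) + v \<in> A j" if "j \<in> Y" for j
      using \<sigma>Y[OF that] inv[OF that] by (force simp: PiE_iff)
    then show "y \<in> (\<lambda>y. \<lambda>j\<in>Y. y (\<sigma> j) + v) -` Pi\<^sub>E Y A \<inter> space (conf Y')"
      using y by (auto simp: space_PiM PiE_iff)
  qed
  have B: "?B i \<in> sets lborel" if "i \<in> Y'" for i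
    using A[OF invY(1)[OF that]] measurable_sets[of "\<lambda>z. z + v" borel borel "A (inv_into Y \<sigma> i)"] by simp
  have "emeasure (distr (conf Y') (conf Y) (\<lambda>y. \<lambda>j\<in>Y. y (\<sigma> j) + v)) (Pi\<^sub>E Y A)
      = emeasure (conf Y') (Pi\<^sub>E Y' ?B)"
    using A fin by (subst emeasure_distr[OF meas]) (auto simp: pre intro: sets_PiM_I_finite)
  also have "\<dots> = (\<Prod>i\<in>Y'. emeasure lborel (?B i))"
    using B finY' by (subst conf.emeasure_PiM) auto
  also have "\<dots> = (\<Prod>i\<in>Y'. emeasure lborel (A (inv_into Y \<sigma> i)))"
    using A invY by (intro prod.cong refl emeasure_lborel_shift) auto
  also have "\<dots> = (\<Prod>j\<in>Y. emeasure lborel (A j))"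
    using inv by (subst prod.reindex_bij_betw[OF \<sigma>, symmetric]) (auto intro!: prod.cong)
  finally show "emeasure (distr (conf Y') (conf Y) (\<lambda>y. \<lambda>j\<in>Y. y (\<sigma> j) + v)) (Pi\<^sub>E Y A)
      = (\<Prod>i\<in>Y. emeasure lborel (A i))" .
qed simp

lemma integral_conf_relabel_shift:
  fixes v :: "'a::euclidean_space" and g :: "(nat \<Rightarrow> 'a) \<Rightarrow> real"
  assumes fin: "finite Y" and \<sigma>: "bij_betw \<sigma> Y Y'" and g: "g \<in> borel_measurable (conf Y)"
  shows "(\<integral>y. g y \<partial>conf Y) = (\<integral>y. g (\<lambda>j\<in>Y. y (\<sigma> j) + v) \<partial>conf Y')"
proof -
  have \<sigma>Y: "\<sigma> j \<in> Y'" if "j \<in> Y" for j using \<sigma> that by (auto simp: bij_betw_def)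
  have meas: "(\<lambda>y. \<lambda>j\<in>Y. y (\<sigma> j) + v) \<in> measurable (conf Y') (conf Y)"
    by (rule measurable_restrict) (use \<sigma>Y in measurable)
  show ?thesis
    using integral_distr[OF meas g] by (simp add: distr_conf_relabel_shift[OF fin \<sigma>])
qed

section \<open>Bounds for graph integrals of a nonnegative weight\<close>

lemma graph_sum_nonneg: "(\<And>v. f v \<ge> 0) \<Longrightarrow> graph_sum f A Y x \<ge> 0"
  by (auto simp: graph_sum_def intro!: sum_nonneg prod_nonneg)

lemma measurable_override_diff [measurable]:
  fixes f :: "'a::euclidean_space \<Rightarrow> real"
  assumes [measurable]: "f \<in> borel_measurable borel"
  shows "(\<lambda>y. f (override_on x y Y i - override_on x y Y j)) \<in> borel_measurable (conf Y :: (nat \<Rightarrow> 'a) measure)"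
proof -
  have [measurable]: "(\<lambda>y. override_on x y Y i) \<in> borel_measurable (conf Y :: (nat \<Rightarrow> 'a) measure)" for i
    by (cases "i \<in> Y") (simp_all add: override_on_def)
  show ?thesis by measurable
qed

lemma measurable_graph_sum [measurable]:
  fixes f :: "'a::euclidean_space \<Rightarrow> real"
  assumes [measurable]: "f \<in> borel_measurable borel"
  shows "(\<lambda>y. graph_sum f A Y' (override_on x y Y)) \<in> borel_measurable (conf Y :: (nat \<Rightarrow> 'a) measure)"
  unfolding graph_sum_def case_prod_unfold by measurable

lemma measurable_prod_diff [measurable]:
  fixes f :: "'a::euclidean_space \<Rightarrow> real"
  assumes [measurable]: "f \<in> borel_measurable borel" and "S \<subseteq> Y"
  shows "(\<lambda>y. \<Prod>s\<in>S. f (c - y s)) \<in> borel_measurable (conf Y :: (nat \<Rightarrow> 'a) measure)"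
proof (rule borel_measurable_prod)
  fix s assume "s \<in> S"
  then have [measurable]: "s \<in> Y" using assms by blast
  show "(\<lambda>y. f (c - y s)) \<in> borel_measurable (conf Y :: (nat \<Rightarrow> 'a) measure)" by measurable
qed

lemma nn_integral_reflect:
  fixes f :: "'a::euclidean_space \<Rightarrow> real"
  assumes [measurable]: "f \<in> borel_measurable borel" and even: "\<And>v. f (- v) = f v"
  shows "(\<integral>\<^sup>+y. ennreal (f (c - y)) \<partial>lborel) = (\<integral>\<^sup>+y. ennreal (f y) \<partial>lborel)"
proof -
  have "(\<integral>\<^sup>+y. ennreal (f y) \<partial>lborel) = (\<integral>\<^sup>+y. ennreal (f y) \<partial>distr lborel borel ((+) (- c)))"
    by (simp only: lborel_distr_plus)
  also have "\<dots> = (\<integral>\<^sup>+y. ennreal (f (- c + y)) \<partial>lborel)"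
    by (subst nn_integral_distr) simp_all
  also have "\<dots> = (\<integral>\<^sup>+y. ennreal (f (c - y)) \<partial>lborel)"
    using even[of "c - y" for y] by simp
  finally show ?thesis ..
qed

lemma nn_integral_root_factor:
  fixes f :: "'a::euclidean_space \<Rightarrow> real"
  assumes [measurable]: "f \<in> borel_measurable borel" and even: "\<And>v. f (- v) = f v"
    and nonneg: "\<And>v. f v \<ge> 0" and S: "finite S"
  shows "(\<integral>\<^sup>+y. ennreal (\<Prod>s\<in>S. f (c - y s)) \<partial>conf S) = (\<integral>\<^sup>+v. ennreal (f v) \<partial>lborel) ^ card S"
proof -
  have "(\<integral>\<^sup>+y. ennreal (\<Prod>s\<in>S. f (c - y s)) \<partial>conf S) = (\<integral>\<^sup>+y. (\<Prod>s\<in>S. ennreal (f (c - y s))) \<partial>conf S)"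
    using nonneg by (simp add: prod_ennreal)
  also have "\<dots> = (\<Prod>s\<in>S. \<integral>\<^sup>+y. ennreal (f (c - y)) \<partial>lborel)"
    using S by (subst conf.product_nn_integral_prod[where f = "\<lambda>_ y. ennreal (f (c - y))"]) auto
  finally show ?thesis by (simp add: nn_integral_reflect even)
qed

text \<open>Tonelli: with the new roots \<open>S\<close> held fixed the integral over
  \<open>T\<close> is at most \<open>K\<close>, and each new root then contributes the integral of
  \<open>f\<close>. The hypothesis is uniform in the root positions because those in
  \<open>S\<close> are integrated afterwards.\<close>

lemma nn_integral_graph_term_le:
  fixes f :: "'a::euclidean_space \<Rightarrow> real"
  assumes [measurable]: "f \<in> borel_measurable borel" and even: "\<And>v. f (- v) = f v"
    and nonneg: "\<And>v. f v \<ge> 0"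
    and fin: "finite S" "finite T" and disj: "S \<inter> T = {}"
    and le: "\<And>x. (\<integral>\<^sup>+z. graph_sum f A T (override_on x z T) \<partial>conf T) \<le> ennreal K"
  shows "(\<integral>\<^sup>+y. ennreal ((\<Prod>s\<in>S. f (c - y s)) * graph_sum f A T (override_on x y (S \<union> T))) \<partial>conf (S \<union> T))
    \<le> (\<integral>\<^sup>+v. ennreal (f v) \<partial>lborel) ^ card S * ennreal K"
proof -
  have gs0: "graph_sum f A T x \<ge> 0" for x using nonneg by (rule graph_sum_nonneg)
  have pr0: "(\<Prod>s\<in>S. f (c - y s)) \<ge> 0" for y using nonneg by (simp add: prod_nonneg)
  have "(\<integral>\<^sup>+y. ennreal ((\<Prod>s\<in>S. f (c - y s)) * graph_sum f A T (override_on x y (S \<union> T))) \<partial>conf (S \<union> T))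
     = (\<integral>\<^sup>+y. \<integral>\<^sup>+z. ennreal ((\<Prod>s\<in>S. f (c - merge S T (y, z) s)) * graph_sum f A T (override_on x (merge S T (y, z)) (S \<union> T))) \<partial>conf T \<partial>conf S)"
    using fin disj by (subst conf.product_nn_integral_fold) auto
  also have "\<dots> = (\<integral>\<^sup>+y. ennreal (\<Prod>s\<in>S. f (c - y s)) * (\<integral>\<^sup>+z. ennreal (graph_sum f A T (override_on (override_on x y S) z T)) \<partial>conf T) \<partial>conf S)"
  proof (rule nn_integral_cong)
    fix y :: "nat \<Rightarrow> 'a"
    have "(\<integral>\<^sup>+z. ennreal ((\<Prod>s\<in>S. f (c - merge S T (y, z) s)) * graph_sum f A T (override_on x (merge S T (y, z)) (S \<union> T))) \<partial>conf T)
      = (\<integral>\<^sup>+z. ennreal (\<Prod>s\<in>S. f (c - y s)) * ennreal (graph_sum f A T (override_on (override_on x y S) z T)) \<partial>conf T)"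
      by (simp add: override_on_merge[OF disj] ennreal_mult[OF pr0 gs0])
         (simp add: merge_def)
    also have "\<dots> = ennreal (\<Prod>s\<in>S. f (c - y s)) * (\<integral>\<^sup>+z. ennreal (graph_sum f A T (override_on (override_on x y S) z T)) \<partial>conf T)"
      by (rule nn_integral_cmult) measurable
    finally show "(\<integral>\<^sup>+z. ennreal ((\<Prod>s\<in>S. f (c - merge S T (y, z) s)) * graph_sum f A T (override_on x (merge S T (y, z)) (S \<union> T))) \<partial>conf T)
      = ennreal (\<Prod>s\<in>S. f (c - y s)) * (\<integral>\<^sup>+z. ennreal (graph_sum f A T (override_on (override_on x y S) z T)) \<partial>conf T)" .
  qed
  also have "\<dots> \<le> (\<integral>\<^sup>+y. ennreal (\<Prod>s\<in>S. f (c - y s)) * ennreal K \<partial>conf S)"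
    by (intro nn_integral_mono mult_left_mono le) simp
  also have "\<dots> = (\<integral>\<^sup>+v. ennreal (f v) \<partial>lborel) ^ card S * ennreal K"
    by (subst nn_integral_multc) (auto simp: nn_integral_root_factor even nonneg fin)
  finally show ?thesis .
qed

text \<open>Serves to prove integrability, with |f| as weight, so the constant may be crude; but it
  must be uniform in the root positions for the induction. Root deletion lowers
  \<open>card A + card Y\<close> by one.\<close>

lemma nn_integral_graph_sum_bounded:
  fixes f :: "'a::euclidean_space \<Rightarrow> real"
  assumes int: "integrable lborel f" and even: "\<And>v. f (- v) = f v"
    and nonneg: "\<And>v. f v \<ge> 0" and bdd: "\<And>v. f v \<le> M"
  shows "\<exists>K\<ge>0. \<forall>A Y x. finite A \<longrightarrow> finite Y \<longrightarrow> A \<inter> Y = {} \<longrightarrow> card A + card Y \<le> n \<longrightarrow>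
    (\<integral>\<^sup>+y. graph_sum f A Y (override_on x y Y) \<partial>conf Y) \<le> ennreal K"
proof -
  have [measurable]: "f \<in> borel_measurable borel" using int by auto
  define C where "C = (\<integral>v. f v \<partial>lborel)"
  have C: "C \<ge> 0" "(\<integral>\<^sup>+v. ennreal (f v) \<partial>lborel) = ennreal C"
    using nonneg int by (auto simp: C_def nn_integral_eq_integral integral_nonneg_AE)
  have M: "M \<ge> 0" using nonneg[of 0] bdd[of 0] by simp
  have gs0: "graph_sum f A T x \<ge> 0" for A T x using nonneg by (rule graph_sum_nonneg)
  have empty: "(\<integral>\<^sup>+y. graph_sum f {} Y (override_on x y Y) \<partial>conf Y) \<le> ennreal 1" if "finite Y" for Y x
    by (cases "Y = {}") (auto simp: graph_sum_empty_roots space_PiM)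
  show ?thesis
  proof (induction n)
    case 0
    have "A = {}" if "finite A" "card A + card Y \<le> 0" for A Y :: "nat set" using that by simp
    then show ?case using empty by (intro exI[of _ 1]) (metis zero_le_one)
  next
    case (Suc n)
    then obtain K where K: "K \<ge> 0" "\<And>A Y x. finite A \<Longrightarrow> finite Y \<Longrightarrow> A \<inter> Y = {} \<Longrightarrow> card A + card Y \<le> n \<Longrightarrow>
      (\<integral>\<^sup>+y. graph_sum f A Y (override_on x y Y) \<partial>conf Y) \<le> ennreal K" by blast
    \<comment> \<open>Origin of the factors: at most n other roots, each with 1 + f \<le> 1 + M; at
      most 2^(n+1) sets \<open>S\<close>; at most n + 1 new roots, each contributing the integral
      \<open>C\<close>. The maximum with 1 covers an empty root set.\<close>
    define K' where "K' = max 1 ((1 + M) ^ n * (2 ^ Suc n * ((1 + C) ^ Suc n * K)))"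
    show ?case
    proof (intro exI[of _ K'] conjI allI impI)
      show "K' \<ge> 0" by (simp add: K'_def)
      fix A Y :: "nat set" and x :: "nat \<Rightarrow> 'a"
      assume fin: "finite A" "finite Y" and AY: "A \<inter> Y = {}" and card: "card A + card Y \<le> Suc n"
      show "(\<integral>\<^sup>+y. graph_sum f A Y (override_on x y Y) \<partial>conf Y) \<le> ennreal K'"
      proof (cases "A = {}")
        case True
        have "ennreal 1 \<le> ennreal K'" by (intro ennreal_leI) (simp add: K'_def)
        then show ?thesis using order_trans[OF empty[OF fin(2)]] True by blast
      next
        case False
        then obtain a A' where A: "A = insert a A'" "a \<notin> A'" by (metis Set.set_insert ex_in_conv)
        have card': "card A' + card Y \<le> n" and finA': "finite A'"
          using card fin A by auto
        have aY: "a \<notin> Y" "A' \<inter> Y = {}" using A AY by auto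
        have KS: "graph_sum f A Y (override_on x y Y) = (\<Prod>j\<in>A'. 1 + f (x a - x j)) *
            (\<Sum>S\<in>Pow Y. (\<Prod>s\<in>S. f (x a - y s)) * graph_sum f (A' \<union> S) (Y - S) (override_on x y Y))" for y
        proof -
          have "(\<Prod>j\<in>A'. 1 + f (override_on x y Y a - override_on x y Y j)) = (\<Prod>j\<in>A'. 1 + f (x a - x j))"
            using aY by (intro prod.cong) (auto simp: override_on_def)
          moreover have "(\<Prod>s\<in>S. f (override_on x y Y a - override_on x y Y s)) = (\<Prod>s\<in>S. f (x a - y s))" if "S \<subseteq> Y" for S
            using aY that by (intro prod.cong) (auto simp: override_on_def)
          ultimately show ?thesis
            unfolding A(1) using aY A(2) fin finA' by (subst graph_sum_insert_root[where f = f, OF _ _ _ _ even]) (auto intro!: sum.cong)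
        qed
        have E: "(\<Prod>j\<in>A'. 1 + f (x a - x j)) \<ge> 0" "(\<Prod>j\<in>A'. 1 + f (x a - x j)) \<le> (1 + M) ^ n"
        proof -
          have "(\<Prod>j\<in>A'. 1 + f (x a - x j)) \<le> (\<Prod>j\<in>A'. 1 + M)"
            using nonneg bdd by (intro prod_mono) (auto intro: add_nonneg_nonneg)
          also have "\<dots> \<le> (1 + M) ^ n"
            using card' M by (auto intro: power_increasing)
          finally show "(\<Prod>j\<in>A'. 1 + f (x a - x j)) \<le> (1 + M) ^ n" .
        qed (use nonneg in \<open>auto intro!: prod_nonneg add_nonneg_nonneg\<close>)
        have tm: "(\<integral>\<^sup>+y. ennreal ((\<Prod>s\<in>S. f (x a - y s)) * graph_sum f (A' \<union> S) (Y - S) (override_on x y Y)) \<partial>conf Y)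
          \<le> ennreal ((1 + C) ^ Suc n * K)" if "S \<subseteq> Y" for S
        proof -
          have finS: "finite S" using that fin finite_subset by blast
          have un: "S \<union> (Y - S) = Y" using that by blast
          have cS: "card (A' \<union> S) + card (Y - S) \<le> n"
          proof -
            have "card (A' \<union> S) + card (Y - S) = card A' + card S + card (Y - S)"
              using aY that finA' finS by (subst card_Un_disjoint) auto
            also have "\<dots> = card A' + card Y"
              using that fin finS by (simp add: card_Diff_subset card_mono)
            finally show ?thesis using card' by simp
          qed
          have "(\<integral>\<^sup>+y. ennreal ((\<Prod>s\<in>S. f (x a - y s)) * graph_sum f (A' \<union> S) (Y - S) (override_on x y (S \<union> (Y - S)))) \<partial>conf (S \<union> (Y - S)))
            \<le> (\<integral>\<^sup>+v. ennreal (f v) \<partial>lborel) ^ card S * ennreal K"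
            using fin finS finA' cS that aY by (intro nn_integral_graph_term_le even nonneg K) auto
          also have "\<dots> = ennreal (C ^ card S * K)"
            using C K by (simp add: ennreal_power ennreal_mult)
          also have "\<dots> \<le> ennreal ((1 + C) ^ Suc n * K)"
          proof (intro ennreal_leI mult_right_mono K)
            have "card S \<le> Suc n" using cS that card card_mono[OF fin(2) that] by simp
            then have "C ^ card S \<le> (1 + C) ^ card S" "(1 + C) ^ card S \<le> (1 + C) ^ Suc n"
              using C by (auto intro: power_mono power_increasing simp del: power_Suc)
            then show "C ^ card S \<le> (1 + C) ^ Suc n" by simp
          qed
          finally show ?thesis unfolding un .
        qed
        have "(\<integral>\<^sup>+y. graph_sum f A Y (override_on x y Y) \<partial>conf Y) =
          (\<integral>\<^sup>+y. ennreal (\<Prod>j\<in>A'. 1 + f (x a - x j)) *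
            (\<Sum>S\<in>Pow Y. ennreal ((\<Prod>s\<in>S. f (x a - y s)) * graph_sum f (A' \<union> S) (Y - S) (override_on x y Y))) \<partial>conf Y)"
          unfolding KS
        proof (intro nn_integral_cong)
          fix y :: "nat \<Rightarrow> 'a"
          have *: "(\<Prod>s\<in>S. f (x a - y s)) * graph_sum f (A' \<union> S) (Y - S) (override_on x y Y) \<ge> 0" for S
            using nonneg gs0 by (simp add: prod_nonneg)
          show "ennreal ((\<Prod>j\<in>A'. 1 + f (x a - x j)) *
              (\<Sum>S\<in>Pow Y. (\<Prod>s\<in>S. f (x a - y s)) * graph_sum f (A' \<union> S) (Y - S) (override_on x y Y)))
            = ennreal (\<Prod>j\<in>A'. 1 + f (x a - x j)) *
              (\<Sum>S\<in>Pow Y. ennreal ((\<Prod>s\<in>S. f (x a - y s)) * graph_sum f (A' \<union> S) (Y - S) (override_on x y Y)))"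
            using * E by (subst sum_ennreal) (auto simp del: ennreal_mult intro!: ennreal_mult sum_nonneg)
        qed
        also have "\<dots> = ennreal (\<Prod>j\<in>A'. 1 + f (x a - x j)) *
            (\<Sum>S\<in>Pow Y. \<integral>\<^sup>+y. ennreal ((\<Prod>s\<in>S. f (x a - y s)) * graph_sum f (A' \<union> S) (Y - S) (override_on x y Y)) \<partial>conf Y)"
          by (subst nn_integral_cmult; (subst nn_integral_sum)?) auto
        also have "\<dots> \<le> ennreal ((1 + M) ^ n) * (\<Sum>S\<in>Pow Y. ennreal ((1 + C) ^ Suc n * K))"
          using E tm by (intro mult_mono sum_mono ennreal_leI) auto
        also have "(\<Sum>S\<in>Pow Y. ennreal ((1 + C) ^ Suc n * K)) \<le> ennreal (2 ^ Suc n * ((1 + C) ^ Suc n * K))"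
        proof -
          have "(\<Sum>S\<in>Pow Y. ennreal ((1 + C) ^ Suc n * K)) = ennreal (\<Sum>S\<in>Pow Y. (1 + C) ^ Suc n * K)"
            using C K by (subst sum_ennreal) auto
          also have "\<dots> = ennreal (2 ^ card Y * ((1 + C) ^ Suc n * K))"
            using fin by (simp add: card_Pow)
          also have "\<dots> \<le> ennreal (2 ^ Suc n * ((1 + C) ^ Suc n * K))"
            using card C K by (intro ennreal_leI mult_right_mono power_increasing mult_nonneg_nonneg) auto
          finally show ?thesis .
        qed
        finally have "(\<integral>\<^sup>+y. graph_sum f A Y (override_on x y Y) \<partial>conf Y)
          \<le> ennreal ((1 + M) ^ n * (2 ^ Suc n * ((1 + C) ^ Suc n * K)))"
          using M C K by (simp add: ennreal_mult mult_left_mono)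
        also have "\<dots> \<le> ennreal K'" by (simp add: K'_def ennreal_leI)
        finally show ?thesis .
      qed
    qed
  qed
qed

section \<open>Correlation functions\<close>

text \<open>The properties of the Mayer function used below, with \<open>u\<close> standing for
  exp(2 \<beta> B). In \<open>stable\<close> the point \<open>a\<close> may depend on the
  configuration \<open>x\<close>; the product is its Boltzmann factor with all other points.\<close>

locale stable_weight =
  fixes f :: "'a::euclidean_space \<Rightarrow> real" and u :: real
  assumes integrable_f: "integrable lborel f"
    and even: "f (- v) = f v"
    and one_plus_nonneg: "0 \<le> 1 + f v"
    and one_plus_le: "1 + f v \<le> u"
    and stable: "finite (A :: nat set) \<Longrightarrow> A \<noteq> {} \<Longrightarrow> \<exists>a\<in>A. (\<Prod>j\<in>A - {a}. 1 + f (x a - x j)) \<le> u"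
begin

lemma borel_f [measurable]: "f \<in> borel_measurable borel"
  using integrable_f by auto

lemma u_nonneg: "0 \<le> u"
  using one_plus_nonneg[of 0] one_plus_le[of 0] by simp

definition C :: real where "C = (\<integral>v. \<bar>f v\<bar> \<partial>lborel)"

lemma C_nonneg: "C \<ge> 0"
  by (simp add: C_def)

lemma abs_f: "integrable lborel (\<lambda>v. \<bar>f v\<bar>)" "\<And>v. \<bar>f (- v)\<bar> = \<bar>f v\<bar>" "\<And>v. \<bar>f v\<bar> \<ge> 0" "\<And>v. \<bar>f v\<bar> \<le> u + 1"
proof -
  fix v show "\<bar>f v\<bar> \<le> u + 1"
    using one_plus_nonneg[of v] one_plus_le[of v] u_nonneg by (auto simp: abs_le_iff)
qed (use integrable_f even in auto)

lemma nn_integral_abs_f: "(\<integral>\<^sup>+v. ennreal \<bar>f v\<bar> \<partial>lborel) = ennreal C"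
  unfolding C_def using abs_f by (intro nn_integral_eq_integral) auto

lemma abs_graph_sum_le: "\<bar>graph_sum f A Y x\<bar> \<le> graph_sum (\<lambda>v. \<bar>f v\<bar>) A Y x"
  unfolding graph_sum_def by (rule order_trans[OF sum_abs]) (simp add: abs_prod case_prod_unfold)

lemma abs_graph_sum_bounded:
  assumes "finite A" "finite Y" "A \<inter> Y = {}"
  obtains K where "K \<ge> 0"
    "\<And>x. (\<integral>\<^sup>+y. graph_sum (\<lambda>v. \<bar>f v\<bar>) A Y (override_on x y Y) \<partial>conf Y) \<le> ennreal K"
  using nn_integral_graph_sum_bounded[where f = "\<lambda>v. \<bar>f v\<bar>" and n = "card A + card Y", OF abs_f] assms
  by (metis order_refl)

lemma integrable_abs_graph_sum:
  assumes "finite A" "finite Y" "A \<inter> Y = {}"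
  shows "integrable (conf Y) (\<lambda>y. graph_sum (\<lambda>v. \<bar>f v\<bar>) A Y (override_on x y Y))"
proof -
  obtain K where "(\<integral>\<^sup>+y. graph_sum (\<lambda>v. \<bar>f v\<bar>) A Y (override_on x y Y) \<partial>conf Y) \<le> ennreal K"
    using abs_graph_sum_bounded[OF assms] by blast
  also have "\<dots> < \<infinity>" by simp
  finally show ?thesis
    by (intro integrableI_nonneg) (auto simp: graph_sum_nonneg)
qed

lemma integrable_graph:
  assumes "finite A" "finite Y" "A \<inter> Y = {}" "E \<in> rooted_graphs A Y"
  shows "integrable (conf Y) (\<lambda>y. \<Prod>(i, j)\<in>E. f (override_on x y Y i - override_on x y Y j))"
proof (rule Bochner_Integration.integrable_bound[OF integrable_abs_graph_sum[OF assms(1-3), of x]])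
  show "AE y in conf Y. norm (\<Prod>(i, j)\<in>E. f (override_on x y Y i - override_on x y Y j))
    \<le> norm (graph_sum (\<lambda>v. \<bar>f v\<bar>) A Y (override_on x y Y))"
  proof (rule AE_I2)
    fix y
    have "norm (\<Prod>(i, j)\<in>E. f (override_on x y Y i - override_on x y Y j))
       = (\<Prod>(i, j)\<in>E. \<bar>f (override_on x y Y i - override_on x y Y j)\<bar>)"
      by (simp add: abs_prod case_prod_unfold)
    also have "\<dots> \<le> graph_sum (\<lambda>v. \<bar>f v\<bar>) A Y (override_on x y Y)"
      unfolding graph_sum_def using assms
      by (intro member_le_sum) (auto simp: finite_rooted_graphs intro!: prod_nonneg)
    finally show "norm (\<Prod>(i, j)\<in>E. f (override_on x y Y i - override_on x y Y j))
      \<le> norm (graph_sum (\<lambda>v. \<bar>f v\<bar>) A Y (override_on x y Y))" by simp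
  qed
qed (simp add: case_prod_unfold)

definition graph_int :: "nat set \<Rightarrow> nat set \<Rightarrow> (nat \<Rightarrow> 'a) \<Rightarrow> real" where
  "graph_int A Y x = (\<integral>y. graph_sum f A Y (override_on x y Y) \<partial>conf Y)"

lemma graph_int_cong: "(\<And>i. i \<in> A \<Longrightarrow> x i = x' i) \<Longrightarrow> graph_int A Y x = graph_int A Y x'"
  unfolding graph_int_def
  by (intro Bochner_Integration.integral_cong refl graph_sum_cong) (auto simp: override_on_def)

lemma graph_int_empty_roots: "graph_int {} Y x = (if Y = {} then 1 else 0)"
  unfolding graph_int_def graph_sum_empty_roots by (auto simp: space_PiM measure_def)

lemma graph_int_relabel_shift:
  assumes fin: "finite A" "finite Y" "A \<inter> Y = {}" and inj: "inj_on \<pi> (A \<union> Y)"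
  shows "graph_int (\<pi> ` A) (\<pi> ` Y) (\<lambda>i. x i + v) = graph_int A Y (x \<circ> \<pi>)"
proof -
  define \<sigma> where "\<sigma> = inv_into Y \<pi>"
  have injY: "inj_on \<pi> Y" using inj by (simp add: inj_on_Un)
  have \<sigma>: "bij_betw \<sigma> (\<pi> ` Y) Y"
    unfolding \<sigma>_def using injY by (simp add: bij_betw_inv_into inj_on_imp_bij_betw)
  have \<sigma>\<pi>: "\<sigma> (\<pi> i) = i" if "i \<in> Y" for i using that injY by (simp add: \<sigma>_def)
  have "graph_int (\<pi> ` A) (\<pi> ` Y) (\<lambda>i. x i + v) = (\<integral>y. graph_sum f (\<pi> ` A) (\<pi> ` Y)
      (override_on (\<lambda>i. x i + v) (\<lambda>j\<in>\<pi> ` Y. y (\<sigma> j) + v) (\<pi> ` Y)) \<partial>conf Y)"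
    unfolding graph_int_def using fin by (intro integral_conf_relabel_shift \<sigma>) auto
  also have "\<dots> = (\<integral>y. graph_sum f A Y (override_on (x \<circ> \<pi>) y Y) \<partial>conf Y)"
  proof (intro Bochner_Integration.integral_cong refl)
    fix y :: "nat \<Rightarrow> 'a"
    have "graph_sum f (\<pi> ` A) (\<pi> ` Y) (override_on (\<lambda>i. x i + v) (\<lambda>j\<in>\<pi> ` Y. y (\<sigma> j) + v) (\<pi> ` Y))
      = graph_sum f A Y (override_on (\<lambda>i. x i + v) (\<lambda>j\<in>\<pi> ` Y. y (\<sigma> j) + v) (\<pi> ` Y) \<circ> \<pi>)"
      using assms even by (rule graph_sum_relabel)
    also have "\<dots> = graph_sum f A Y (\<lambda>i. override_on (x \<circ> \<pi>) y Y i + v)"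
    proof (rule graph_sum_cong)
      fix i assume i: "i \<in> A \<union> Y"
      show "(override_on (\<lambda>i. x i + v) (\<lambda>j\<in>\<pi> ` Y. y (\<sigma> j) + v) (\<pi> ` Y) \<circ> \<pi>) i
        = override_on (x \<circ> \<pi>) y Y i + v"
      proof (cases "i \<in> Y")
        case True then show ?thesis by (simp add: override_on_def \<sigma>\<pi>)
      next
        case False
        then have "\<pi> i \<notin> \<pi> ` Y" using i inj by (auto simp: inj_on_def)
        then show ?thesis using False by (simp add: override_on_def)
      qed
    qed
    finally show "graph_sum f (\<pi> ` A) (\<pi> ` Y) (override_on (\<lambda>i. x i + v) (\<lambda>j\<in>\<pi> ` Y. y (\<sigma> j) + v) (\<pi> ` Y))
      = graph_sum f A Y (override_on (x \<circ> \<pi>) y Y)"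
      by (simp add: graph_sum_translate)
  qed
  finally show ?thesis by (simp add: graph_int_def)
qed

lemma graph_int_relabel:
  assumes "finite A" "finite Y" "A \<inter> Y = {}" "inj_on \<pi> (A \<union> Y)"
  shows "graph_int (\<pi> ` A) (\<pi> ` Y) x = graph_int A Y (x \<circ> \<pi>)"
  using graph_int_relabel_shift[OF assms, of x 0] by simp

lemma graph_int_shift:
  assumes "finite A" "finite Y" "A \<inter> Y = {}"
  shows "graph_int A Y (\<lambda>i. x i + v) = graph_int A Y x"
  using graph_int_relabel_shift[OF assms, of id x v] by simp

text \<open>Integrated points are dummy variables, so only their number matters: relabel them and
  leave \<open>A\<close> fixed.\<close>

lemma graph_int_change_Y:
  assumes fin: "finite A" "finite Y" "finite Y'" and "A \<inter> Y = {}" "A \<inter> Y' = {}" "card Y = card Y'"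
  shows "graph_int A Y x = graph_int A Y' x"
proof -
  obtain h where h: "bij_betw h Y' Y" using assms finite_same_card_bij by metis
  define \<pi> where "\<pi> i = (if i \<in> Y' then h i else i)" for i
  have \<pi>A: "\<pi> i = i" if "i \<in> A" for i using that assms by (auto simp: \<pi>_def)
  have A: "\<pi> ` A = A" using \<pi>A by force
  have Y: "\<pi> ` Y' = Y" using h by (auto simp: \<pi>_def bij_betw_def)
  have "inj_on \<pi> A" using \<pi>A by (simp add: inj_on_def)
  moreover have "inj_on \<pi> Y'"
    using h by (simp add: \<pi>_def bij_betw_def cong: inj_on_cong)
  moreover have "\<pi> ` (A - Y') \<inter> \<pi> ` (Y' - A) = {}"
    using A Y assms(4) by blast
  ultimately have "inj_on \<pi> (A \<union> Y')" by (simp only: inj_on_Un)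
  then have "graph_int A Y x = graph_int A Y' (x \<circ> \<pi>)"
    using graph_int_relabel[of A Y' \<pi> x] assms A Y by simp
  also have "\<dots> = graph_int A Y' x"
    using assms by (intro graph_int_cong) (auto simp: \<pi>_def)
  finally show ?thesis .
qed

lemma integrable_term:
  assumes fin: "finite A" "finite S" "finite T" and disj: "A \<inter> S = {}" "A \<inter> T = {}" "S \<inter> T = {}"
  shows "integrable (conf (S \<union> T)) (\<lambda>y. (\<Prod>s\<in>S. f (c - y s)) * graph_sum f (A \<union> S) T (override_on x y (S \<union> T)))"
proof -
  let ?f = "\<lambda>v. \<bar>f v\<bar>"
  obtain K where K: "\<And>x. (\<integral>\<^sup>+y. graph_sum ?f (A \<union> S) T (override_on x y T) \<partial>conf T) \<le> ennreal K"
    using abs_graph_sum_bounded[of "A \<union> S" T] fin disj by (metis Int_Un_distrib2 Un_empty finite_UnI)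
  have "(\<integral>\<^sup>+y. ennreal ((\<Prod>s\<in>S. ?f (c - y s)) * graph_sum ?f (A \<union> S) T (override_on x y (S \<union> T))) \<partial>conf (S \<union> T))
      \<le> (\<integral>\<^sup>+v. ennreal \<bar>f v\<bar> \<partial>lborel) ^ card S * ennreal K"
    by (rule nn_integral_graph_term_le[OF _ abs_f(2,3) fin(2,3) disj(3) K]) measurable
  also have "\<dots> < \<infinity>"
    by (simp add: nn_integral_abs_f ennreal_power C_nonneg ennreal_mult_less_top)
  finally have *: "integrable (conf (S \<union> T)) (\<lambda>y. (\<Prod>s\<in>S. ?f (c - y s)) * graph_sum ?f (A \<union> S) T (override_on x y (S \<union> T)))"
    by (intro integrableI_nonneg) (auto simp: graph_sum_nonneg prod_nonneg)
  show ?thesis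
  proof (rule Bochner_Integration.integrable_bound[OF *])
    show "AE y in conf (S \<union> T). norm ((\<Prod>s\<in>S. f (c - y s)) * graph_sum f (A \<union> S) T (override_on x y (S \<union> T)))
      \<le> norm ((\<Prod>s\<in>S. ?f (c - y s)) * graph_sum ?f (A \<union> S) T (override_on x y (S \<union> T)))"
      using abs_graph_sum_le
      by (intro AE_I2) (simp add: abs_mult abs_prod graph_sum_nonneg mult_left_mono prod_nonneg)
  qed measurable
qed

lemma inner_integral_term:
  assumes "S \<inter> T = {}"
  shows "(\<integral>z. (\<Prod>s\<in>S. f (c - merge S T (y, z) s)) * graph_sum f A T (override_on x (merge S T (y, z)) (S \<union> T)) \<partial>conf T)
    = (\<Prod>s\<in>S. f (c - y s)) * graph_int A T (override_on x y S)"
proof -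
  have "(\<Prod>s\<in>S. f (c - merge S T (y, z) s)) = (\<Prod>s\<in>S. f (c - y s))" for z
    by (simp add: merge_def)
  then show ?thesis by (simp add: override_on_merge[OF assms] graph_int_def)
qed

text \<open>Fubini for the new roots \<open>S\<close> and the remaining points \<open>T\<close>. It
  also supplies the measurability of \<open>graph_int\<close> in the positions of the new
  roots.\<close>

lemma
  assumes fin: "finite A" "finite S" "finite T" and disj: "A \<inter> S = {}" "A \<inter> T = {}" "S \<inter> T = {}"
  shows integrable_root_factor_graph_int:
      "integrable (conf S) (\<lambda>y. (\<Prod>s\<in>S. f (c - y s)) * graph_int (A \<union> S) T (override_on x y S))" (is ?int)
    and integral_term: "(\<integral>y. (\<Prod>s\<in>S. f (c - y s)) * graph_sum f (A \<union> S) T (override_on x y (S \<union> T)) \<partial>conf (S \<union> T))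
      = (\<integral>y. (\<Prod>s\<in>S. f (c - y s)) * graph_int (A \<union> S) T (override_on x y S) \<partial>conf S)" (is ?eq)
proof -
  let ?g = "\<lambda>y. (\<Prod>s\<in>S. f (c - y s)) * graph_sum f (A \<union> S) T (override_on x y (S \<union> T))"
  have int: "integrable (conf (S \<union> T)) ?g"
    using assms by (rule integrable_term)
  interpret S: finite_product_sigma_finite "\<lambda>_::nat. lborel :: 'a measure" S by standard fact
  interpret T: finite_product_sigma_finite "\<lambda>_::nat. lborel :: 'a measure" T by standard fact
  interpret P: pair_sigma_finite "conf S :: (nat \<Rightarrow> 'a) measure" "conf T :: (nat \<Rightarrow> 'a) measure" ..
  have "integrable (conf S \<Otimes>\<^sub>M conf T) (\<lambda>p. ?g (merge S T p))"
    by (rule integrable_distr[OF measurable_merge]) (simp only: conf.distr_merge[OF disj(3) fin(2,3)] int)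
  then have "integrable (conf S) (\<lambda>y. \<integral>z. ?g (merge S T (y, z)) \<partial>conf T)"
    by (rule P.integrable_fst')
  then show ?int by (simp only: inner_integral_term[OF disj(3)])
  show ?eq
    by (subst conf.product_integral_fold[OF disj(3) fin(2,3) int]) (simp only: inner_integral_term[OF disj(3)])
qed

lemma graph_int_insert_root:
  assumes a: "a \<notin> A \<union> Y" and AY: "A \<inter> Y = {}" and fin: "finite A" "finite Y"
  shows "graph_int (insert a A) Y x = (\<Prod>j\<in>A. 1 + f (x a - x j)) *
    (\<Sum>S\<in>Pow Y. \<integral>y. (\<Prod>s\<in>S. f (x a - y s)) * graph_int (A \<union> S) (Y - S) (override_on x y S) \<partial>conf S)"
proof -
  have un: "S \<union> (Y - S) = Y" if "S \<subseteq> Y" for S using that by blast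
  have cond: "finite S" "finite (Y - S)" "A \<inter> S = {}" "A \<inter> (Y - S) = {}" "S \<inter> (Y - S) = {}"
    if "S \<subseteq> Y" for S using that AY fin finite_subset by auto
  have KS: "graph_sum f (insert a A) Y (override_on x y Y) = (\<Prod>j\<in>A. 1 + f (x a - x j)) *
      (\<Sum>S\<in>Pow Y. (\<Prod>s\<in>S. f (x a - y s)) * graph_sum f (A \<union> S) (Y - S) (override_on x y Y))" for y
  proof -
    have "(\<Prod>j\<in>A. 1 + f (override_on x y Y a - override_on x y Y j)) = (\<Prod>j\<in>A. 1 + f (x a - x j))"
      using a AY by (intro prod.cong) (auto simp: override_on_def)
    moreover have "(\<Prod>s\<in>S. f (override_on x y Y a - override_on x y Y s)) = (\<Prod>s\<in>S. f (x a - y s))" if "S \<subseteq> Y" for S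
      using a that by (intro prod.cong) (auto simp: override_on_def)
    ultimately show ?thesis
      using a AY fin by (subst graph_sum_insert_root[where f = f, OF _ _ _ _ even]) (auto intro!: sum.cong)
  qed
  have int: "integrable (conf Y) (\<lambda>y. (\<Prod>s\<in>S. f (x a - y s)) * graph_sum f (A \<union> S) (Y - S) (override_on x y Y))"
    if "S \<in> Pow Y" for S
    using integrable_term[OF fin(1) cond, of S] that un by simp
  have "graph_int (insert a A) Y x = (\<Prod>j\<in>A. 1 + f (x a - x j)) *
     (\<Sum>S\<in>Pow Y. \<integral>y. (\<Prod>s\<in>S. f (x a - y s)) * graph_sum f (A \<union> S) (Y - S) (override_on x y Y) \<partial>conf Y)"
    unfolding graph_int_def KS using int by (simp add: Bochner_Integration.integral_sum)
  also have "(\<Sum>S\<in>Pow Y. \<integral>y. (\<Prod>s\<in>S. f (x a - y s)) * graph_sum f (A \<union> S) (Y - S) (override_on x y Y) \<partial>conf Y)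
    = (\<Sum>S\<in>Pow Y. \<integral>y. (\<Prod>s\<in>S. f (x a - y s)) * graph_int (A \<union> S) (Y - S) (override_on x y S) \<partial>conf S)"
    using integral_term[OF fin(1) cond] un by (intro sum.cong refl) simp
  finally show ?thesis .
qed

end

section \<open>Collecting subsets by size, and fresh labels\<close>

lemma sum_Pow_card:
  fixes g :: "nat \<Rightarrow> real"
  assumes "finite Y"
  shows "(\<Sum>S\<in>Pow Y. g (card S)) = (\<Sum>j\<le>card Y. real (card Y choose j) * g j)"
proof -
  have "(\<Sum>S\<in>Pow Y. g (card S)) = (\<Sum>j\<le>card Y. \<Sum>S\<in>{S \<in> Pow Y. card S = j}. g (card S))"
    using assms by (intro sum.group[symmetric]) (auto intro: card_mono)
  also have "\<dots> = (\<Sum>j\<le>card Y. real (card Y choose j) * g j)"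
    using assms by (intro sum.cong refl) (simp add: n_subsets)
  finally show ?thesis .
qed

lemma sum_atMost_split_0: "(\<Sum>j\<le>m. g j) = g 0 + (\<Sum>j=1..m. g j)" for g :: "nat \<Rightarrow> real"
  using sum.atLeast_Suc_atMost[of 0 m g] by (simp add: atLeast0AtMost)

lemma sum_triangle_swap:
  fixes g :: "nat \<Rightarrow> nat \<Rightarrow> real"
  shows "(\<Sum>i\<le>k. \<Sum>j\<le>i. g j (i - j)) = (\<Sum>j\<le>k. \<Sum>i\<le>k - j. g j i)"
proof -
  have "(\<Sum>i\<le>k. \<Sum>j\<le>i. g j (i - j)) = (\<Sum>(j, i)\<in>{(j, i). j + i \<le> k}. g j i)"
    by (rule sum.triangle_reindex_eq[symmetric])
  also have "{(j, i). j + i \<le> k} = (SIGMA j:{..k}. {..k - j})" by auto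
  finally show ?thesis by (simp add: sum.Sigma)
qed

text \<open>A canonical choice of k labels outside \<open>A\<close>; by
  \<open>graph_int_change_Y\<close> the choice does not affect the integrals. The inserted 0 keeps
  \<open>Max\<close> meaningful for empty \<open>A\<close>.\<close>

definition fresh :: "nat set \<Rightarrow> nat \<Rightarrow> nat set" where
  "fresh A k = {Suc (Max (insert 0 A))..<Suc (Max (insert 0 A)) + k}"

lemma fresh:
  assumes "finite A"
  shows "finite (fresh A k)" "card (fresh A k) = k" "A \<inter> fresh A k = {}"
proof -
  have "a < Suc (Max (insert 0 A))" if "a \<in> A" for a
    using that assms by (simp add: le_imp_less_Suc)
  then show "A \<inter> fresh A k = {}" by (force simp: fresh_def)
qed (simp_all add: fresh_def)

context stable_weight
begin

text \<open>The coefficient of \<open>z\<^sup>k\<close> in the correlation function of the points \<open>x i\<close>, \<open>i \<in> A\<close>, divided by \<open>z\<^sup>|\<^sup>A\<^sup>|\<close>.\<close>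
definition corr :: "nat set \<Rightarrow> nat \<Rightarrow> (nat \<Rightarrow> 'a) \<Rightarrow> real" where
  "corr A k x = graph_int A (fresh A k) x / fact k"

lemma graph_int_eq_corr:
  assumes "finite A" "finite Y" "A \<inter> Y = {}" "card Y = k"
  shows "graph_int A Y x = fact k * corr A k x"
  unfolding corr_def using graph_int_change_Y[of A Y "fresh A k" x] assms fresh[of A k] by simp

lemma corr_cong: "(\<And>i. i \<in> A \<Longrightarrow> x i = x' i) \<Longrightarrow> corr A k x = corr A k x'"
  unfolding corr_def using graph_int_cong by metis

lemma corr_empty_roots: "corr {} k x = (if k = 0 then 1 else 0)"
  by (simp add: corr_def graph_int_empty_roots fresh_def)

lemma corr_relabel:
  assumes A: "finite A" and inj: "inj_on \<pi> A"
  shows "corr (\<pi> ` A) k x = corr A k (x \<circ> \<pi>)"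
proof -
  define Y where "Y = fresh (A \<union> \<pi> ` A) k"
  have Y: "finite Y" "card Y = k" "A \<inter> Y = {}" "\<pi> ` A \<inter> Y = {}"
    using fresh[of "A \<union> \<pi> ` A" k] A by (auto simp: Y_def)
  define \<tau> where "\<tau> i = (if i \<in> A then \<pi> i else i)" for i
  have \<tau>A: "\<tau> ` A = \<pi> ` A" by (simp add: \<tau>_def)
  have \<tau>Y: "\<tau> ` Y = Y" using Y(3) by (force simp: \<tau>_def)
  have "inj_on \<tau> A" using inj by (simp add: \<tau>_def cong: inj_on_cong)
  moreover have "inj_on \<tau> Y" using Y(3) by (auto simp: \<tau>_def inj_on_def)
  moreover have "\<tau> ` (A - Y) \<inter> \<tau> ` (Y - A) = {}" using \<tau>A \<tau>Y Y(4) by blast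
  ultimately have "inj_on \<tau> (A \<union> Y)" by (simp only: inj_on_Un)
  then have "graph_int (\<pi> ` A) Y x = graph_int A Y (x \<circ> \<tau>)"
    using graph_int_relabel[of A Y \<tau> x] A Y by (simp add: \<tau>A \<tau>Y)
  also have "\<dots> = graph_int A Y (x \<circ> \<pi>)" by (rule graph_int_cong) (simp add: \<tau>_def)
  finally show ?thesis
    using graph_int_eq_corr[of "\<pi> ` A" Y k x] graph_int_eq_corr[of A Y k "x \<circ> \<pi>"] A Y by simp
qed

text \<open>Translation invariance enters here: the coefficients of the one-point function depend
  neither on the label nor on the position, so they can be taken out of the integrals when the
  equations are divided by that series.\<close>

lemma corr_singleton: "corr {a} k x = corr {0} k (\<lambda>_. 0)"
proof -
  have "corr {a} k x = corr {0} k (x \<circ> (\<lambda>_. a))"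
    using corr_relabel[of "{0}" "\<lambda>_. a" k x] by simp
  also have "\<dots> = corr {0} k (\<lambda>i. (\<lambda>_. 0) i + x a)"
    by (simp add: comp_def)
  also have "\<dots> = corr {0} k (\<lambda>_. 0)"
    unfolding corr_def using fresh[of "{0}" k] by (subst graph_int_shift) auto
  finally show ?thesis .
qed

text \<open>The part of the Kirkwood--Salsburg operator in which a deleted root at \<open>c\<close>
  has exactly the neighbours \<open>S\<close> among the integrated points.\<close>

definition corr_step :: "nat set \<Rightarrow> nat set \<Rightarrow> nat \<Rightarrow> (nat \<Rightarrow> 'a) \<Rightarrow> 'a \<Rightarrow> real" where
  "corr_step A S i x c = (\<integral>y. (\<Prod>s\<in>S. f (c - y s)) * corr (A \<union> S) i (override_on x y S) \<partial>conf S)"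

lemma integrable_root_factor_corr:
  assumes "finite A" "finite S" "A \<inter> S = {}"
  shows "integrable (conf S) (\<lambda>y. (\<Prod>s\<in>S. f (c - y s)) * corr (A \<union> S) i (override_on x y S))"
proof -
  have "integrable (conf S) (\<lambda>y. (\<Prod>s\<in>S. f (c - y s)) * graph_int (A \<union> S) (fresh (A \<union> S) i) (override_on x y S) / fact i)"
    using fresh[of "A \<union> S" i] assms
    by (intro integrable_divide_zero integrable_root_factor_graph_int) auto
  then show ?thesis by (simp add: corr_def)
qed

text \<open>The new roots are integrated, so only their number matters; this lets the sum over
  neighbour sets be collected by size.\<close>

lemma corr_step_change_S:
  assumes fin: "finite A" "finite S" "finite S'" and disj: "A \<inter> S = {}" "A \<inter> S' = {}"
    and card: "card S = card S'"
  shows "corr_step A S i x c = corr_step A S' i x c"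
proof -
  obtain \<sigma> where \<sigma>: "bij_betw \<sigma> S S'" using fin card finite_same_card_bij by metis
  define \<tau> where "\<tau> i = (if i \<in> A then i else inv_into S \<sigma> i)" for i
  have inv: "inv_into S \<sigma> ` S' = S" "inj_on (inv_into S \<sigma>) S'"
    using bij_betw_inv_into[OF \<sigma>] by (auto simp: bij_betw_def)
  have \<sigma>inv: "\<sigma> (inv_into S \<sigma> i) = i" "inv_into S \<sigma> i \<in> S" if "i \<in> S'" for i
    using \<sigma> that by (auto simp: bij_betw_def f_inv_into_f inv_into_into)
  have \<tau>A: "\<tau> ` A = A" by (simp add: \<tau>_def)
  have \<tau>eq: "\<tau> i = inv_into S \<sigma> i" if "i \<in> S'" for i using that disj by (auto simp: \<tau>_def)
  have \<tau>S: "\<tau> ` S' = S" using inv \<tau>eq by (simp cong: image_cong)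
  have "inj_on \<tau> A" by (simp add: \<tau>_def inj_on_def)
  moreover have "inj_on \<tau> S'" using inv(2) \<tau>eq by (simp cong: inj_on_cong)
  moreover have "\<tau> ` (A - S') \<inter> \<tau> ` (S' - A) = {}" using \<tau>A \<tau>S disj by blast
  ultimately have inj: "inj_on \<tau> (A \<union> S')" by (simp only: inj_on_Un)
  have "corr_step A S i x c = (\<integral>y. (\<Prod>s\<in>S. f (c - (\<lambda>j\<in>S. y (\<sigma> j) + 0) s)) * corr (A \<union> S) i (override_on x (\<lambda>j\<in>S. y (\<sigma> j) + 0) S) \<partial>conf S')"
    unfolding corr_step_def
    using integral_conf_relabel_shift[OF fin(2) \<sigma> borel_measurable_integrable[OF integrable_root_factor_corr[OF fin(1,2) disj(1), of c i x]], of 0]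
    by simp
  also have "\<dots> = corr_step A S' i x c"
    unfolding corr_step_def
  proof (intro Bochner_Integration.integral_cong refl arg_cong2[where f = "(*)"])
    fix y :: "nat \<Rightarrow> 'a"
    have "(\<Prod>s\<in>S. f (c - (\<lambda>j\<in>S. y (\<sigma> j) + 0) s)) = (\<Prod>s\<in>S. f (c - y (\<sigma> s)))" by simp
    also have "\<dots> = (\<Prod>s\<in>S'. f (c - y s))" by (rule prod.reindex_bij_betw[OF \<sigma>])
    finally show "(\<Prod>s\<in>S. f (c - (\<lambda>j\<in>S. y (\<sigma> j) + 0) s)) = (\<Prod>s\<in>S'. f (c - y s))" .
    have "corr (A \<union> S) i (override_on x (\<lambda>j\<in>S. y (\<sigma> j) + 0) S) = corr (A \<union> S') i (override_on x (\<lambda>j\<in>S. y (\<sigma> j) + 0) S \<circ> \<tau>)"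
      using corr_relabel[of "A \<union> S'" \<tau>] inj fin by (simp add: image_Un \<tau>A \<tau>S)
    also have "\<dots> = corr (A \<union> S') i (override_on x y S')"
    proof (rule corr_cong)
      fix j assume "j \<in> A \<union> S'"
      then consider "j \<in> A" "j \<notin> S" "j \<notin> S'" | "j \<in> S'" using disj by blast
      then show "(override_on x (\<lambda>j\<in>S. y (\<sigma> j) + 0) S \<circ> \<tau>) j = override_on x y S' j"
        by cases (simp_all add: override_on_def \<tau>eq \<sigma>inv, simp add: \<tau>_def)
    qed
    finally show "corr (A \<union> S) i (override_on x (\<lambda>j\<in>S. y (\<sigma> j) + 0) S) = corr (A \<union> S') i (override_on x y S')" .
  qed
  finally show ?thesis .
qed

lemma corr_insert_root:
  assumes a: "a \<notin> A" and A: "finite A"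
  shows "corr (insert a A) k x = (\<Prod>j\<in>A. 1 + f (x a - x j)) *
    (\<Sum>j\<le>k. corr_step A (fresh A j) (k - j) x (x a) / fact j)"
proof -
  define Y where "Y = fresh (insert a A) k"
  have Y: "finite Y" "card Y = k" "insert a A \<inter> Y = {}"
    using fresh[of "insert a A" k] A by (auto simp: Y_def)
  have "fact k * corr (insert a A) k x = graph_int (insert a A) Y x"
    using graph_int_eq_corr[of "insert a A" Y k x] A Y by simp
  also have "\<dots> = (\<Prod>j\<in>A. 1 + f (x a - x j)) *
    (\<Sum>S\<in>Pow Y. \<integral>y. (\<Prod>s\<in>S. f (x a - y s)) * graph_int (A \<union> S) (Y - S) (override_on x y S) \<partial>conf S)"
    using a A Y by (intro graph_int_insert_root) auto
  also have "(\<Sum>S\<in>Pow Y. \<integral>y. (\<Prod>s\<in>S. f (x a - y s)) * graph_int (A \<union> S) (Y - S) (override_on x y S) \<partial>conf S)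
    = (\<Sum>S\<in>Pow Y. fact (k - card S) * corr_step A (fresh A (card S)) (k - card S) x (x a))"
  proof (intro sum.cong refl)
    fix S assume "S \<in> Pow Y"
    then have S: "S \<subseteq> Y" "finite S" using Y finite_subset by auto
    have "graph_int (A \<union> S) (Y - S) z = fact (k - card S) * corr (A \<union> S) (k - card S) z" for z
      using A S Y by (intro graph_int_eq_corr) (auto simp: card_Diff_subset)
    then have "(\<integral>y. (\<Prod>s\<in>S. f (x a - y s)) * graph_int (A \<union> S) (Y - S) (override_on x y S) \<partial>conf S)
      = fact (k - card S) * corr_step A S (k - card S) x (x a)"
      by (simp add: corr_step_def mult.left_commute)
    also have "corr_step A S (k - card S) x (x a) = corr_step A (fresh A (card S)) (k - card S) x (x a)"
      using fresh[of A "card S"] A S Y by (intro corr_step_change_S) auto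
    finally show "(\<integral>y. (\<Prod>s\<in>S. f (x a - y s)) * graph_int (A \<union> S) (Y - S) (override_on x y S) \<partial>conf S)
      = fact (k - card S) * corr_step A (fresh A (card S)) (k - card S) x (x a)" .
  qed
  \<comment> \<open>The number of sets of size j times (k - j)! is k! / j!, so the normalisation by
    k! in \<open>corr\<close> leaves 1 / j!.\<close>
  also have "\<dots> = (\<Sum>j\<le>k. real (k choose j) * (fact (k - j) * corr_step A (fresh A j) (k - j) x (x a)))"
    using sum_Pow_card[OF Y(1), of "\<lambda>j. fact (k - j) * corr_step A (fresh A j) (k - j) x (x a)"] Y(2) by simp
  also have "\<dots> = fact k * (\<Sum>j\<le>k. corr_step A (fresh A j) (k - j) x (x a) / fact j)"
    unfolding sum_distrib_left by (intro sum.cong refl) (simp add: binomial_fact)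
  finally show ?thesis by simp
qed

text \<open>\<open>G = \<rho>(z) / z\<close>\<close>
definition G :: "real fps" where
  "G = Abs_fps (\<lambda>k. corr {0} k (\<lambda>_. 0))"

section \<open>Division by the one-point function\<close>

definition F :: "real fps" where
  "F = inverse G"

lemma G_0: "G $ 0 = 1"
  using corr_insert_root[of 0 "{}" 0 "\<lambda>_. 0"]
  by (simp add: G_def corr_step_def fresh_def corr_empty_roots space_PiM measure_def)

lemma GF: "G * F = 1"
  unfolding F_def using G_0 by (simp add: inverse_mult_eq_1')

lemma F_0: "F $ 0 = 1"
  by (simp add: F_def G_0)

text \<open>As \<open>corr\<close>, but for the correlation function divided by \<open>\<rho>(z) / z\<close>.\<close>
definition ncorr :: "nat set \<Rightarrow> nat \<Rightarrow> (nat \<Rightarrow> 'a) \<Rightarrow> real" where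
  "ncorr A k x = (\<Sum>i\<le>k. F $ (k - i) * corr A i x)"

text \<open>The undivided zero-point function is 1, so division makes it \<open>F\<close>: the
  series to be estimated becomes the member of the hierarchy without points.\<close>

lemma ncorr_empty_roots: "ncorr {} k x = F $ k"
proof -
  have "ncorr {} k x = (\<Sum>i\<le>k. if i = 0 then F $ k else 0)"
    unfolding ncorr_def corr_empty_roots by (intro sum.cong) auto
  then show ?thesis by simp
qed

text \<open>Here the recursion ends: at one point the divided function is known exactly, before
  anything is known about the size of \<open>F\<close>.\<close>

lemma ncorr_singleton: "ncorr {a} k x = (if k = 0 then 1 else 0)"
proof -
  have "ncorr {a} k x = (G * F) $ k"
    unfolding ncorr_def fps_mult_nth corr_singleton[of a] by (simp add: G_def atLeast0AtMost mult.commute)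
  then show ?thesis by (simp add: GF)
qed

lemma
  assumes A: "finite A" "finite S" "A \<inter> S = {}"
  shows integrable_root_factor_ncorr:
      "integrable (conf S) (\<lambda>y. (\<Prod>s\<in>S. f (c - y s)) * ncorr (A \<union> S) k (override_on x y S))"
    and integral_root_factor_ncorr: "(\<integral>y. (\<Prod>s\<in>S. f (c - y s)) * ncorr (A \<union> S) k (override_on x y S) \<partial>conf S)
      = (\<Sum>i\<le>k. F $ (k - i) * corr_step A S i x c)"
proof -
  have *: "(\<lambda>y. (\<Prod>s\<in>S. f (c - y s)) * ncorr (A \<union> S) k (override_on x y S))
    = (\<lambda>y. \<Sum>i\<le>k. F $ (k - i) * ((\<Prod>s\<in>S. f (c - y s)) * corr (A \<union> S) i (override_on x y S)))"
    by (simp add: ncorr_def sum_distrib_left mult.left_commute)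
  note int = integrable_mult_right[OF integrable_root_factor_corr[OF A]]
  show "integrable (conf S) (\<lambda>y. (\<Prod>s\<in>S. f (c - y s)) * ncorr (A \<union> S) k (override_on x y S))"
    unfolding * by (intro Bochner_Integration.integrable_sum int)
  show "(\<integral>y. (\<Prod>s\<in>S. f (c - y s)) * ncorr (A \<union> S) k (override_on x y S) \<partial>conf S)
      = (\<Sum>i\<le>k. F $ (k - i) * corr_step A S i x c)"
    unfolding * by (subst Bochner_Integration.integral_sum) (auto simp: corr_step_def integrable_root_factor_corr[OF A])
qed

text \<open>The undivided equation is linear, so convolving its orders with the coefficients of
  \<open>F\<close> reproduces its form after the two summations are exchanged.\<close>

lemma ncorr_insert_root:
  assumes a: "a \<notin> A" and A: "finite A"
  shows "ncorr (insert a A) k x = (\<Prod>j\<in>A. 1 + f (x a - x j)) *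
    (\<Sum>j\<le>k. (\<integral>y. (\<Prod>s\<in>fresh A j. f (x a - y s)) * ncorr (A \<union> fresh A j) (k - j) (override_on x y (fresh A j)) \<partial>conf (fresh A j)) / fact j)"
proof -
  let ?corr_step = "\<lambda>j i. corr_step A (fresh A j) i x (x a) / fact j"
  have "ncorr (insert a A) k x = (\<Prod>j\<in>A. 1 + f (x a - x j)) * (\<Sum>i\<le>k. \<Sum>j\<le>i. F $ (k - j - (i - j)) * ?corr_step j (i - j))"
    unfolding ncorr_def corr_insert_root[OF a A] sum_distrib_left
    by (intro sum.cong refl) (simp add: sum_distrib_left)
  also have "(\<Sum>i\<le>k. \<Sum>j\<le>i. F $ (k - j - (i - j)) * ?corr_step j (i - j)) = (\<Sum>j\<le>k. \<Sum>i\<le>k - j. F $ (k - j - i) * ?corr_step j i)"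
    by (rule sum_triangle_swap)
  also have "\<dots> = (\<Sum>j\<le>k. (\<integral>y. (\<Prod>s\<in>fresh A j. f (x a - y s)) * ncorr (A \<union> fresh A j) (k - j) (override_on x y (fresh A j)) \<partial>conf (fresh A j)) / fact j)"
    using A fresh[of A] by (simp add: integral_root_factor_ncorr sum_divide_distrib)
  finally show ?thesis .
qed

lemma abs_integral_root_factor_ncorr_le:
  assumes A: "finite A" "finite S" "A \<inter> S = {}" and le: "\<And>x. \<bar>ncorr (A \<union> S) k x\<bar> \<le> K"
  shows "\<bar>\<integral>y. (\<Prod>s\<in>S. f (c - y s)) * ncorr (A \<union> S) k (override_on x y S) \<partial>conf S\<bar> \<le> C ^ card S * K"
proof -
  have K: "K \<ge> 0" using le[of x] by simp
  have "ennreal \<bar>\<integral>y. (\<Prod>s\<in>S. f (c - y s)) * ncorr (A \<union> S) k (override_on x y S) \<partial>conf S\<bar>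
     \<le> (\<integral>\<^sup>+y. ennreal \<bar>(\<Prod>s\<in>S. f (c - y s)) * ncorr (A \<union> S) k (override_on x y S)\<bar> \<partial>conf S)"
    using integral_norm_bound_ennreal[OF integrable_root_factor_ncorr[OF A]] by simp
  also have "\<dots> \<le> (\<integral>\<^sup>+y. ennreal (\<Prod>s\<in>S. \<bar>f (c - y s)\<bar>) * ennreal K \<partial>conf S)"
    using le K by (intro nn_integral_mono) (auto simp: abs_mult abs_prod prod_nonneg ennreal_mult[symmetric] intro!: ennreal_leI mult_left_mono)
  also have "\<dots> = (\<integral>\<^sup>+v. ennreal \<bar>f v\<bar> \<partial>lborel) ^ card S * ennreal K"
    by (subst nn_integral_multc) (auto simp: nn_integral_root_factor[where f = "\<lambda>v. \<bar>f v\<bar>"] even A(2))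
  also have "\<dots> = ennreal (C ^ card S * K)"
    using K C_nonneg by (simp add: nn_integral_abs_f ennreal_power ennreal_mult)
  finally show ?thesis using K C_nonneg by simp
qed

text \<open>The equation holds for every choice of the deleted root, and the bound is pointwise; so
  at each configuration the root given by \<open>stable\<close> is deleted, at the cost of a factor
  \<open>u\<close>. With at least two roots another one remains, hence the empty root set, where
  \<open>F\<close> would reappear, is never reached.\<close>

lemma abs_ncorr_le:
  assumes "finite A" "A \<noteq> {}"
  shows "\<bar>ncorr A k x\<bar> \<le> C ^ k * maj u (card A) k"
  using assms
proof (induction "card A + k" arbitrary: A k x rule: less_induct)
  case less
  show ?case
  proof (cases "card A = 1")
    case True
    then obtain a where "A = {a}" by (auto simp: card_1_singleton_iff)
    then show ?thesis by (simp add: ncorr_singleton maj_def)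
  next
    case False
    then have card2: "card A \<ge> 2" using less.prems by (cases "card A") (auto simp: Suc_le_eq)
    obtain a where aA: "a \<in> A" and le: "(\<Prod>j\<in>A - {a}. 1 + f (x a - x j)) \<le> u"
      using stable[OF less.prems(1,2), of x] by blast
    define A' where "A' = A - {a}"
    have A': "A = insert a A'" "a \<notin> A'" "finite A'" "card A = Suc (card A')"
      using aA less.prems card_Suc_Diff1[of A a] by (auto simp: A'_def)
    have nz: "A' \<noteq> {}" using A' card2 by auto
    have bound: "\<bar>\<integral>y. (\<Prod>s\<in>fresh A' j. f (x a - y s)) * ncorr (A' \<union> fresh A' j) (k - j) (override_on x y (fresh A' j)) \<partial>conf (fresh A' j)\<bar>
      \<le> C ^ k * maj u (card A - 1 + j) (k - j)" if "j \<le> k" for j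
    proof -
      note fr = fresh[OF A'(3), of j]
      have cU: "card (A' \<union> fresh A' j) = card A - 1 + j"
        using fr A' by (subst card_Un_disjoint) auto
      have "\<bar>\<integral>y. (\<Prod>s\<in>fresh A' j. f (x a - y s)) * ncorr (A' \<union> fresh A' j) (k - j) (override_on x y (fresh A' j)) \<partial>conf (fresh A' j)\<bar>
        \<le> C ^ card (fresh A' j) * (C ^ (k - j) * maj u (card A - 1 + j) (k - j))"
      proof (rule abs_integral_root_factor_ncorr_le)
        fix z :: "nat \<Rightarrow> 'a"
        \<comment> \<open>The induction measure falls by exactly one: j roots are gained, one is
          lost, and the order falls by j.\<close>
        have "card (A' \<union> fresh A' j) + (k - j) < card A + k" using cU that A' by simp
        then show "\<bar>ncorr (A' \<union> fresh A' j) (k - j) z\<bar> \<le> C ^ (k - j) * maj u (card A - 1 + j) (k - j)"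
          using less.hyps[of "A' \<union> fresh A' j" "k - j" z] fr A' nz by (simp only: cU) auto
      qed (use fr A' in auto)
      also have "\<dots> = C ^ k * maj u (card A - 1 + j) (k - j)"
        using that by (simp add: fr mult.assoc[symmetric] power_add[symmetric])
      finally show ?thesis .
    qed
    have E0: "(\<Prod>j\<in>A'. 1 + f (x a - x j)) \<ge> 0" by (simp add: prod_nonneg one_plus_nonneg)
    have "\<bar>ncorr A k x\<bar> = (\<Prod>j\<in>A'. 1 + f (x a - x j)) *
      \<bar>\<Sum>j\<le>k. (\<integral>y. (\<Prod>s\<in>fresh A' j. f (x a - y s)) * ncorr (A' \<union> fresh A' j) (k - j) (override_on x y (fresh A' j)) \<partial>conf (fresh A' j)) / fact j\<bar>"
      unfolding A'(1) ncorr_insert_root[OF A'(2,3)] abs_mult using E0 by simp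
    also have "\<dots> \<le> u * (\<Sum>j\<le>k. C ^ k * maj u (card A - 1 + j) (k - j) / fact j)"
    proof (rule mult_mono)
      show "(\<Prod>j\<in>A'. 1 + f (x a - x j)) \<le> u" using le by (simp add: A'_def)
      show "\<bar>\<Sum>j\<le>k. (\<integral>y. (\<Prod>s\<in>fresh A' j. f (x a - y s)) * ncorr (A' \<union> fresh A' j) (k - j) (override_on x y (fresh A' j)) \<partial>conf (fresh A' j)) / fact j\<bar>
        \<le> (\<Sum>j\<le>k. C ^ k * maj u (card A - 1 + j) (k - j) / fact j)"
        using bound by (intro sum_abs[THEN order_trans] sum_mono) (simp add: divide_right_mono)
    qed (use u_nonneg in auto)
    also have "\<dots> = C ^ k * maj u (card A) k"
      by (simp add: maj_rec[OF card2] sum_distrib_left mult_ac)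
    finally show ?thesis .
  qed
qed

text \<open>The equation at one point has left side 0 in every order m \<ge> 1. Its term without new
  roots is the zero-point function, that is \<open>F $ m\<close>; solving for it leaves terms with j
  \<ge> 1 roots, which \<open>abs_ncorr_le\<close> bounds.\<close>

lemma abs_F_le:
  assumes "m \<ge> 1"
  shows "\<bar>F $ m\<bar> \<le> C ^ m * (u ^ (m - 1) * real (m - 1) ^ (m - 1) / fact m)"
proof -
  define J where "J j = (\<integral>y. (\<Prod>s\<in>fresh {} j. f (0 - y s)) * ncorr ({} \<union> fresh {} j) (m - j) (override_on (\<lambda>_. 0) y (fresh {} j)) \<partial>conf (fresh {} j))" for j
  have "J 0 = F $ m"
    by (simp add: J_def fresh_def ncorr_empty_roots space_PiM measure_def)
  moreover have "0 = (\<Sum>j\<le>m. J j / fact j)"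
    using ncorr_insert_root[of 0 "{}" m "\<lambda>_. 0"] assms by (simp add: ncorr_singleton J_def)
  moreover have "(\<Sum>j\<le>m. J j / fact j) = J 0 + (\<Sum>j=1..m. J j / fact j)"
    using sum_atMost_split_0[of "\<lambda>j. J j / fact j" m] by simp
  ultimately have "F $ m = - (\<Sum>j=1..m. J j / fact j)" by simp
  then have "\<bar>F $ m\<bar> \<le> (\<Sum>j=1..m. \<bar>J j / fact j\<bar>)"
    by (metis abs_minus_cancel sum_abs)
  also have "\<dots> \<le> (\<Sum>j=1..m. C ^ m * maj u j (m - j) / fact j)"
  proof (rule sum_mono)
    fix j assume j: "j \<in> {1..m}"
    note fr = fresh[OF finite.emptyI, of j]
    have "\<bar>J j\<bar> \<le> C ^ card (fresh {} j) * (C ^ (m - j) * maj u j (m - j))"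
      unfolding J_def
    proof (rule abs_integral_root_factor_ncorr_le)
      fix z :: "nat \<Rightarrow> 'a"
      have "fresh {} j \<noteq> {}" using fr(2) j by auto
      then show "\<bar>ncorr ({} \<union> fresh {} j) (m - j) z\<bar> \<le> C ^ (m - j) * maj u j (m - j)"
        using abs_ncorr_le[OF fr(1), of "m - j" z] fr(2) by simp
    qed (use fr in auto)
    also have "\<dots> = C ^ m * maj u j (m - j)"
      using j by (simp add: fr mult.assoc[symmetric] power_add[symmetric])
    finally show "\<bar>J j / fact j\<bar> \<le> C ^ m * maj u j (m - j) / fact j"
      by (simp add: divide_right_mono)
  qed
  also have "\<dots> = C ^ m * (\<Sum>j=1..m. maj u j (m - j) / fact j)"
    by (simp add: sum_distrib_left)
  finally show ?thesis by (simp only: maj_sum[OF assms])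
qed

text \<open>A graph is connected iff every vertex is reached from vertex 0, so the cluster integrals
  are those of the one-point function with its root at the origin.\<close>

lemma sum_conn_graphs:
  "(\<Sum>E\<in>conn_graphs (Suc k). \<integral>x. (\<Prod>(i, j)\<in>E. f ((if i = 0 then 0 else x i) - (if j = 0 then 0 else x j))) \<partial>conf {1..<Suc k})
   = fact k * G $ k"
proof -
  let ?Y = "{1..<Suc k}"
  have "(\<Sum>E\<in>conn_graphs (Suc k). \<integral>x. (\<Prod>(i, j)\<in>E. f ((if i = 0 then 0 else x i) - (if j = 0 then 0 else x j))) \<partial>conf ?Y)
    = (\<Sum>E\<in>rooted_graphs {0} ?Y. \<integral>y. (\<Prod>(i, j)\<in>E. f (override_on (\<lambda>_. 0) y ?Y i - override_on (\<lambda>_. 0) y ?Y j)) \<partial>conf ?Y)"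
  proof (rule sum.cong)
    show "conn_graphs (Suc k) = rooted_graphs {0} ?Y" by (rule conn_graphs_eq) simp
    fix E assume E: "E \<in> rooted_graphs {0} ?Y"
    then have "i < Suc k" "j < Suc k" if "(i, j) \<in> E" for i j
      using that by (auto simp: rooted_graphs_def edges_def subset_iff)
    then show "(\<integral>x. (\<Prod>(i, j)\<in>E. f ((if i = 0 then 0 else x i) - (if j = 0 then 0 else x j))) \<partial>conf ?Y)
      = (\<integral>y. (\<Prod>(i, j)\<in>E. f (override_on (\<lambda>_. 0) y ?Y i - override_on (\<lambda>_. 0) y ?Y j)) \<partial>conf ?Y)"
      by (intro Bochner_Integration.integral_cong prod.cong refl) (auto simp: override_on_def)
  qed
  also have "\<dots> = graph_int {0} ?Y (\<lambda>_. 0)"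
    unfolding graph_int_def graph_sum_def
    by (rule Bochner_Integration.integral_sum[symmetric]) (rule integrable_graph[of "{0}"]; simp)
  also have "\<dots> = fact k * corr {0} k (\<lambda>_. 0)"
    by (rule graph_int_eq_corr) auto
  finally show ?thesis by (simp add: G_def)
qed

end

section \<open>Stable pair potentials\<close>

lemma sum_ge_imp_ex_ge:
  fixes g :: "'b \<Rightarrow> real"
  assumes "finite A" "A \<noteq> {}" "(\<Sum>a\<in>A. g a) \<ge> real (card A) * K"
  shows "\<exists>a\<in>A. g a \<ge> K"
proof (rule ccontr)
  assume "\<not> ?thesis"
  then have "(\<Sum>a\<in>A. g a) < (\<Sum>a\<in>A. K)"
    using assms by (intro sum_strict_mono) (auto simp: not_le)
  with assms(3) show False by simp
qed

text \<open>Every pair is counted from both ends; this is the 2 in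
  \<open>exp (2 * \<beta> * B)\<close>.\<close>

lemma sum_offdiag_symmetric:
  fixes g :: "nat \<Rightarrow> nat \<Rightarrow> real"
  assumes "\<And>i j. g i j = g j i"
  shows "(\<Sum>i<N. \<Sum>j\<in>{..<N} - {i}. g i j) = 2 * (\<Sum>i<N. \<Sum>j\<in>{i<..<N}. g i j)"
proof -
  have "(\<Sum>j\<in>{..<N} - {i}. g i j) = (\<Sum>j\<in>{i<..<N}. g i j) + (\<Sum>j\<in>{j \<in> {..<N}. j < i}. g i j)" if "i < N" for i
  proof -
    have *: "{..<N} - {i} = {i<..<N} \<union> {j \<in> {..<N}. j < i}" using that by auto
    show ?thesis unfolding * by (rule sum.union_disjoint) auto
  qed
  then have "(\<Sum>i<N. \<Sum>j\<in>{..<N} - {i}. g i j)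
    = (\<Sum>i<N. \<Sum>j\<in>{i<..<N}. g i j) + (\<Sum>i<N. \<Sum>j\<in>{j \<in> {..<N}. j < i}. g i j)"
    by (simp add: sum.distrib)
  also have "(\<Sum>i<N. \<Sum>j\<in>{j \<in> {..<N}. j < i}. g i j) = (\<Sum>j<N. \<Sum>i\<in>{i \<in> {..<N}. j < i}. g i j)"
    by (rule sum.swap_restrict) auto
  also have "\<dots> = (\<Sum>j<N. \<Sum>i\<in>{j<..<N}. g j i)"
    using assms by (intro sum.cong) auto
  finally show ?thesis by simp
qed

text \<open>The interactions of each point with all the others add up to twice the energy, hence to
  at least -2 B N for N points. By averaging, some point has interaction at least -2 B.\<close>

lemma stable_weight_mayer:
  fixes \<phi> :: "'a::euclidean_space \<Rightarrow> ereal"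
  assumes cent: "central \<phi>" and B: "B \<ge> 0" and stab: "stable_with \<phi> B"
    and temp: "integrable lborel (mayer \<beta> \<phi>)" and \<beta>: "\<beta> > 0"
  shows "stable_weight (mayer \<beta> \<phi>) (exp (2 * \<beta> * B))"
proof
  have phi_even: "\<phi> (- v) = \<phi> v" for v
    using cent unfolding central_def by (metis norm_minus_cancel)
  \<comment> \<open>Stability for the two points \<open>v\<close> and 0. It bounds 1 + f by exp(2
    \<beta> B) and excludes the value minus infinity.\<close>
  have phi_ge: "\<phi> v \<ge> ereal (- 2 * B)" for v
  proof -
    have "(\<Sum>i<2::nat. \<Sum>j\<in>{i<..<2}. \<phi> ((if i = 0 then v else 0) - (if j = 0 then v else 0))) \<ge> ereal (- B * real 2)"
      using stab[unfolded stable_with_def, rule_format, of 2 "\<lambda>i. if i = 0 then v else 0"] by simp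
    also have "{0<..<2::nat} = {1}" "{Suc 0<..<2} = {}" by auto
    then have "(\<Sum>i<2::nat. \<Sum>j\<in>{i<..<2}. \<phi> ((if i = 0 then v else 0) - (if j = 0 then v else 0))) = \<phi> v"
      by (simp add: numeral_2_eq_2 lessThan_Suc)
    finally show ?thesis by (simp add: mult.commute)
  qed
  then have not_minf: "\<phi> v \<noteq> - \<infinity>" for v by (metis MInfty_neq_ereal(1) ereal_infty_less_eq(2))
  have m: "1 + mayer \<beta> \<phi> v = (if \<phi> v = \<infinity> then 0 else exp (- \<beta> * real_of_ereal (\<phi> v)))" for v
    by (simp add: mayer_def)
  show "integrable lborel (mayer \<beta> \<phi>)" by fact
  show "mayer \<beta> \<phi> (- v) = mayer \<beta> \<phi> v" for v by (simp add: mayer_def phi_even)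
  show "0 \<le> 1 + mayer \<beta> \<phi> v" for v by (simp add: m)
  show "1 + mayer \<beta> \<phi> v \<le> exp (2 * \<beta> * B)" for v
  proof (cases "\<phi> v = \<infinity>")
    case False
    then obtain r where r: "\<phi> v = ereal r" using not_minf by (cases "\<phi> v") auto
    then have "\<beta> * (- 2 * B) \<le> \<beta> * r" using phi_ge[of v] \<beta> by (intro mult_left_mono) auto
    then show ?thesis by (simp add: m r)
  qed (simp add: m)
  fix A :: "nat set" and x :: "nat \<Rightarrow> 'a"
  assume A: "finite A" "A \<noteq> {}"
  let ?w = "\<lambda>a j. 1 + mayer \<beta> \<phi> (x a - x j)"
  show "\<exists>a\<in>A. (\<Prod>j\<in>A - {a}. ?w a j) \<le> exp (2 * \<beta> * B)"
  \<comment> \<open>For a hard-core overlap a factor of the product is 0. Otherwise all pair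
    energies in \<open>A\<close> are finite and can be summed as reals.\<close>
  proof (cases "\<exists>a\<in>A. \<exists>j\<in>A - {a}. \<phi> (x a - x j) = \<infinity>")
    case True
    then obtain a j where "a \<in> A" "j \<in> A - {a}" "\<phi> (x a - x j) = \<infinity>" by blast
    moreover from this have "(\<Prod>j\<in>A - {a}. ?w a j) = 0"
      using A by (intro prod_zero) (auto simp: m)
    ultimately show ?thesis by (intro bexI[of _ a]) auto
  next
    case False
    define g where "g a j = real_of_ereal (\<phi> (x a - x j))" for a j
    have g: "\<phi> (x a - x j) = ereal (g a j)" if "a \<in> A" "j \<in> A" "a \<noteq> j" for a j
      using False not_minf that unfolding g_def by (cases "\<phi> (x a - x j)") auto
    have g_sym: "g a j = g j a" for a j
      using phi_even[of "x a - x j"] by (simp add: g_def)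
    obtain e where e: "bij_betw e {..<card A} A"
      using A ex_bij_betw_nat_finite[of A] by (auto simp: atLeast0LessThan)
    have eA: "e i \<in> A" if "i < card A" for i using e that by (auto simp: bij_betw_def)
    have e_inj: "e i = e j \<longleftrightarrow> i = j" if "i < card A" "j < card A" for i j
      using e that by (auto simp: bij_betw_def inj_on_def)
    have "ereal (- B * real (card A)) \<le> (\<Sum>i<card A. \<Sum>j\<in>{i<..<card A}. \<phi> (x (e i) - x (e j)))"
      using stab[unfolded stable_with_def, rule_format, of "card A" "x \<circ> e"] by simp
    also have "\<dots> = (\<Sum>i<card A. \<Sum>j\<in>{i<..<card A}. ereal (g (e i) (e j)))"
      by (intro sum.cong refl g) (auto simp: eA e_inj)
    also have "\<dots> = ereal (\<Sum>i<card A. \<Sum>j\<in>{i<..<card A}. g (e i) (e j))" by simp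
    finally have U: "- B * real (card A) \<le> (\<Sum>i<card A. \<Sum>j\<in>{i<..<card A}. g (e i) (e j))" by simp
    have "(\<Sum>a\<in>A. \<Sum>j\<in>A - {a}. g a j) = (\<Sum>i<card A. \<Sum>j\<in>A - {e i}. g (e i) j)"
      by (rule sum.reindex_bij_betw[OF e, symmetric])
    also have "\<dots> = (\<Sum>i<card A. \<Sum>j\<in>{..<card A} - {i}. g (e i) (e j))"
    proof (rule sum.cong[OF refl])
      fix i assume "i \<in> {..<card A}"
      then have "bij_betw e ({..<card A} - {i}) (A - {e i})"
        using bij_betw_DiffI[OF e, of "{i}" "{e i}"] eA by (simp add: bij_betw_def)
      then show "(\<Sum>j\<in>A - {e i}. g (e i) j) = (\<Sum>j\<in>{..<card A} - {i}. g (e i) (e j))"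
        by (rule sum.reindex_bij_betw[symmetric])
    qed
    also have "\<dots> = 2 * (\<Sum>i<card A. \<Sum>j\<in>{i<..<card A}. g (e i) (e j))"
      by (rule sum_offdiag_symmetric) (rule g_sym)
    finally have "real (card A) * (- 2 * B) \<le> (\<Sum>a\<in>A. \<Sum>j\<in>A - {a}. g a j)"
      using U by (simp add: mult.commute)
    then obtain a where a: "a \<in> A" "- 2 * B \<le> (\<Sum>j\<in>A - {a}. g a j)"
      using sum_ge_imp_ex_ge[OF A] by blast
    have "(\<Prod>j\<in>A - {a}. ?w a j) = (\<Prod>j\<in>A - {a}. exp (- \<beta> * g a j))"
      using a by (intro prod.cong refl) (simp add: m g)
    also have "\<dots> = exp (- \<beta> * (\<Sum>j\<in>A - {a}. g a j))"
      using A by (simp add: exp_sum[symmetric] sum_distrib_left sum_negf)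
    also have "\<dots> \<le> exp (2 * \<beta> * B)"
      using mult_left_mono[OF a(2), of \<beta>] \<beta> by simp
    finally show ?thesis using a by blast
  qed
qed

section \<open>The virial coefficients\<close>

theorem theorem7p2:
  fixes \<phi> :: "'a::euclidean_space \<Rightarrow> ereal"
    and B \<beta> u c :: real
  assumes cent: "central \<phi>"
    and B_nonneg: "B \<ge> 0"
    and stab: "stable_with \<phi> B"
    and temp: "integrable (lborel :: 'a measure) (mayer \<beta> \<phi>)"
    and beta_pos: "\<beta> > 0"
    and u_def: "u = exp (2 * \<beta> * B)"
    and c_sol: "c \<in> c_solutions u"
    and c_least: "\<forall>c'\<in>c_solutions u. c \<le> c'"
  shows "(\<forall>n\<ge>1. \<bar>virial_coeff \<beta> \<phi> (n + 1)\<bar> / fact (n + 1)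
            \<le> Cbeta \<beta> \<phi> ^ n / real (n + 1) * ((1 + T1 (u * c) / u) / c) ^ n)
       \<and> ereal (c / (1 + T1 (u * c) / u)) / ereal (Cbeta \<beta> \<phi>)
            \<le> conv_radius (\<lambda>n. virial_coeff \<beta> \<phi> n / fact n)"
proof -
  interpret stable_weight "mayer \<beta> \<phi>" u
    unfolding u_def by (rule stable_weight_mayer) fact+
  have C: "Cbeta \<beta> \<phi> = C" by (simp add: Cbeta_def C_def)
  have u: "u > 0" by (simp add: u_def)
  have c: "0 < c" "u * c < exp (- 1)" using c_sol by (simp_all add: c_solutions_def)
  define S where "S = 1 + T1 (u * c) / u"
  have cluster: "cluster_coeff \<beta> \<phi> (Suc k) = fact k * G $ k" for k
    unfolding cluster_coeff_def by (rule sum_conn_graphs)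
  have density: "density_fps \<beta> \<phi> = fps_X * G"
    by (rule fps_ext) (auto simp: density_fps_def cluster gr0_conv_Suc)
  \<comment> \<open>As \<rho> = z P', the derivative of P is \<open>G\<close>. Hence one factor of
    \<open>G * F ^ Suc n\<close> cancels in Lagrange inversion and the coefficient of order n of
    \<open>F ^ n\<close> remains.\<close>
  have pressure: "fps_deriv (pressure_fps \<beta> \<phi>) = G"
    by (rule fps_ext) (simp add: pressure_fps_def cluster del: of_nat_Suc)
  have virial: "virial_coeff \<beta> \<phi> (Suc n) / fact (Suc n) = (F ^ n) $ n / real (Suc n)" for n
  proof -
    have "G * F ^ Suc n = F ^ n" by (simp add: mult.assoc[symmetric] GF)
    then have "real (Suc n) * (pressure_fps \<beta> \<phi> oo fps_inv (density_fps \<beta> \<phi>)) $ Suc n = (F ^ n) $ n"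
      unfolding density lagrange_inversion[OF GF] pressure by (simp only:)
    then show ?thesis by (simp add: virial_coeff_def field_simps del: of_nat_Suc)
  qed
  have F_pow: "\<bar>(F ^ n) $ n\<bar> \<le> (C * (S / c)) ^ n" for n
  proof (cases "C = 0")
    \<comment> \<open>The radius \<open>c / C\<close> needs \<open>C\<close> nonzero. For
      \<open>C = 0\<close> all higher coefficients of \<open>F\<close> vanish.\<close>
    case True
    then have "F $ m = 0" if "m \<ge> 1" for m using abs_F_le[OF that] that by (simp add: power_0_left)
    then have "F = 1" using F_0 by (intro fps_ext) (auto simp: not_less_eq_eq)
    then show ?thesis using True by simp
  next
    case False
    then have C0: "C > 0" using C_nonneg by simp
    \<comment> \<open>At radius \<open>c / C\<close> the powers of \<open>C\<close> in
      \<open>abs_F_le\<close> cancel, leaving a partial sum of the series of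
      \<open>T1 (u * c) / u\<close>.\<close>
    have "(\<Sum>m\<le>n. \<bar>F $ m\<bar> * (c / C) ^ m) = 1 + (\<Sum>m=1..n. \<bar>F $ m\<bar> * (c / C) ^ m)"
      by (simp add: sum_atMost_split_0 F_0)
    also have "\<dots> \<le> 1 + (\<Sum>m=1..n. u ^ (m - 1) * real (m - 1) ^ (m - 1) / fact m * c ^ m)"
    proof (intro add_left_mono sum_mono)
      fix m assume "m \<in> {1..n}"
      then have "\<bar>F $ m\<bar> * (c / C) ^ m \<le> C ^ m * (u ^ (m - 1) * real (m - 1) ^ (m - 1) / fact m) * (c / C) ^ m"
        using c C0 by (intro mult_right_mono abs_F_le) auto
      also have "\<dots> = u ^ (m - 1) * real (m - 1) ^ (m - 1) / fact m * c ^ m"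
        using C0 by (simp add: power_divide)
      finally show "\<bar>F $ m\<bar> * (c / C) ^ m \<le> u ^ (m - 1) * real (m - 1) ^ (m - 1) / fact m * c ^ m" .
    qed
    also have "\<dots> \<le> S"
      unfolding S_def using T1_partial_sum[OF u _ c(2)] c by simp
    finally have "\<bar>(F ^ n) $ n\<bar> \<le> S ^ n / (c / C) ^ n"
      using c C0 by (intro fps_power_nth_le) auto
    then show ?thesis using C0 c by (simp add: power_divide power_mult_distrib mult.commute)
  qed
  have S: "S \<ge> 1"
  proof -
    have "0 \<le> T1 (u * c) / u"
      using T1_partial_sum[OF u _ c(2), of 0] c by simp
    then show ?thesis by (simp add: S_def)
  qed
  have bound: "\<bar>virial_coeff \<beta> \<phi> (Suc n) / fact (Suc n)\<bar> \<le> (C * (S / c)) ^ n / real (Suc n)" for n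
    unfolding virial using F_pow[of n] by (simp add: divide_right_mono del: of_nat_Suc)
  have "ereal (c / S) / ereal C \<le> conv_radius (\<lambda>n. virial_coeff \<beta> \<phi> n / fact n)"
  proof (rule conv_radius_geI_ex)
    fix r :: real assume r: "0 < r" "ereal r < ereal (c / S) / ereal C"
    define t where "t = C * (S / c) * r"
    have t: "0 \<le> t" "t < 1"
    proof -
      show "0 \<le> t" using C_nonneg S c r by (simp add: t_def)
      show "t < 1"
      \<comment> \<open>For \<open>C = 0\<close> the \<open>ereal\<close> quotient is infinite and
        leaves \<open>r\<close> unrestricted, but then \<open>t\<close> is 0.\<close>
      proof (cases "C = 0")
        case False
        then have "r < c / S / C" using r by simp
        then show ?thesis using False C_nonneg S c by (simp add: t_def field_simps)
      qed (simp add: t_def)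
    qed
    \<comment> \<open>The bound concerns index n + 1, so the comparison starts at the second term;
      the surplus power of \<open>r\<close> is the factor in front of \<open>t ^ n\<close>.\<close>
    have "summable (\<lambda>n. virial_coeff \<beta> \<phi> (Suc n) / fact (Suc n) * r ^ Suc n)"
    proof (rule summable_comparison_test')
      show "summable (\<lambda>n. r * t ^ n)"
        using t by (intro summable_mult summable_geometric) auto
      fix n :: nat
      have "(C * (S / c)) ^ n / real (Suc n) \<le> (C * (S / c)) ^ n"
        using divide_left_mono[of 1 "real (Suc n)" "(C * (S / c)) ^ n"] C_nonneg S c by simp
      then have "\<bar>virial_coeff \<beta> \<phi> (Suc n) / fact (Suc n)\<bar> * r ^ Suc n \<le> (C * (S / c)) ^ n * r ^ Suc n"
        using bound[of n] r by (intro mult_right_mono) (auto simp del: of_nat_Suc)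
      also have "(C * (S / c)) ^ n * r ^ Suc n = r * t ^ n"
        unfolding t_def power_mult_distrib by simp
      finally show "norm (virial_coeff \<beta> \<phi> (Suc n) / fact (Suc n) * r ^ Suc n) \<le> r * t ^ n"
        using r by (simp add: abs_mult del: of_nat_Suc fact_Suc power_Suc)
    qed
    then have "summable (\<lambda>n. virial_coeff \<beta> \<phi> n / fact n * r ^ n)"
      by (subst (asm) summable_Suc_iff)
    then show "\<exists>z. norm z = r \<and> summable (\<lambda>n. virial_coeff \<beta> \<phi> n / fact n * z ^ n)"
      using r by (intro exI[of _ r]) simp
  qed
  moreover have "\<bar>virial_coeff \<beta> \<phi> (n + 1)\<bar> / fact (n + 1) \<le> C ^ n / real (n + 1) * (S / c) ^ n" for n
    using bound[of n] unfolding power_mult_distrib abs_divide by (simp del: fact_Suc of_nat_Suc)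
  ultimately show ?thesis by (simp add: C S_def)
qed

end
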